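(* Let $K$ be a field and let $H$ be a hypergraph. Any element of the Leavitt path algebra $L_K(H)$ has precisely one normal representative, i.e. precisely one preimage under the quotient map $K\langle X\rangle\to L_K(H)$ that lies in $K\langle X\rangle_{\mathrm{nod}}$. Moreover, the map $\mathrm{NF}:L_K(H)\to K\langle X\rangle_{\mathrm{nod}}$ which associates to each element of $L_K(H)$ its normal representative is an isomorphism of $K$-vector spaces.
   Context: Algebras are associative but not necessarily unital. A multiset over a set $Y$ is a function $M:Y\to\mathbb N_0$; its support is $M_{\mathrm{supp}}=\{y\in Y\mid M(y)>0\}$. $\mathrm{Mult}(Y)$ is the set of multisets over $Y$ with finite, nonempty support, and $|M|=\sum_{y\in M_{\mathrm{supp}}}M(y)$. A (directed) hypergraph is a quadruple $H=(H^0,H^1,s,r)$ where $H^0,H^1$ are sets and $s,r:H^1\to\mathrm{Mult}(H^0)$ are maps. All hypergraphs are assumed nonempty (not $H^0=H^1=\emptyset$). For each $h\in H^1$ fix listings with multiplicity $s(h)=\{s(h)_1,\dots,s(h)_{|s(h)|}\}$ and $r(h)=\{r(h)_1,\dots,r(h)_{|r(h)|}\}$. Let $X:=\{v,h_{ij},h_{ij}^*\mid v\in H^0,h\in H^1,1\le i\le|s(h)|,1\le j\le|r(h)|\}$ and let $K\langle X\rangle$ be the free (nonunital) $K$-algebra on $X$, i.e. the $K$-vector space with basis all nonempty words over $X$, with multiplication given by juxtaposition. The Leavitt path algebra $L_K(H)$ is the quotient of $K\langle X\rangle$ by the ideal generated by the relations: (i) $uv=\delta_{uv}u$ ($u,v\in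 H^0$); (ii) $s(h)_ih_{ij}=h_{ij}=h_{ij}r(h)_j$ and $r(h)_jh_{ij}^*=h_{ij}^*=h_{ij}^*s(h)_i$ for all $h,i,j$; (iii) $\sum_{k=1}^{|r(h)|}h_{ik}h_{jk}^*=\delta_{ij}s(h)_i$ ($h\in H^1$, $1\le i,j\le|s(h)|$); (iv) $\sum_{k=1}^{|s(h)|}h_{ki}^*h_{kj}=\delta_{ij}r(h)_i$ ($h\in H^1$, $1\le i,j\le|r(h)|$). Let $\hat E$ be the directed graph with vertex set $H^0$ and edges all $h_{ij}$ (with source $s(h)_i$ and range $r(h)_j$) and all $h_{ij}^*$ (with source $r(h)_j$ and range $s(h)_i$). A d-path is a path in $\hat E$, i.e. a word over $X$ which is either a single vertex, or a nonempty word $x_1\dots x_n$ of edges of $\hat E$ such that the range of $x_i$ equals the source of $x_{i+1}$ for $1\le i\le n-1$. The words $h_{i1}h_{j1}^*$ ($h\in H^1$, $1\le i,j\le|s(h)|$) and $h_{1i}^*h_{1j}$ ($h\in H^1$, $1\le i,j\le|r(h)|$) are called forbidden. A nod-path is a d-path none of whose (contiguous) subwords is forbidden. $K\langle X\rangle_{\mathrm{nod}}$ denotes the $K$-linear span of all nod-paths in $K\langle X\rangle$. *)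

theory Defs
  imports Complex_Main "HOL-Library.Multiset" "HOL-Library.Sublist" "HOL-Library.Poly_Mapping"
begin

section \<open>Hypergraphs\<close>

record ('v, 'e) hypergraph =
  verts  :: "'v set"
  hedges :: "'e set"
  src    :: "'e \<Rightarrow> 'v multiset"
  rng    :: "'e \<Rightarrow> 'v multiset"

text \<open>Values of \<open>src\<close> and \<open>rng\<close> are finite multisets by typing; only their values on
  \<open>hedges\<close> matter.\<close>

definition hypergraph :: "('v, 'e, 'z) hypergraph_scheme \<Rightarrow> bool" where
  "hypergraph H \<longleftrightarrow>
     (verts H \<noteq> {} \<or> hedges H \<noteq> {}) \<and>
     (\<forall>h\<in>hedges H. src H h \<noteq> {#} \<and> set_mset (src H h) \<subseteq> verts H \<and>
                    rng H h \<noteq> {#} \<and> set_mset (rng H h) \<subseteq> verts H)"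

record ('v, 'e) listed_hypergraph = "('v, 'e) hypergraph" +
  slist :: "'e \<Rightarrow> 'v list"
  rlist :: "'e \<Rightarrow> 'v list"

text \<open>List positions are counted from 0, so the elements \<open>s(h)\<^sub>1, s(h)\<^sub>2, \<dots>\<close> of the literature
  are \<open>slist H h ! 0, slist H h ! 1, \<dots>\<close>, and every index below is shifted by one in the same
  way.\<close>

definition listings :: "('v, 'e) listed_hypergraph \<Rightarrow> bool" where
  "listings H \<longleftrightarrow> (\<forall>h\<in>hedges H. mset (slist H h) = src H h \<and> mset (rlist H h) = rng H h)"


section \<open>Vector spaces and algebras on carrier sets\<close>

text \<open>The Leavitt path algebra is a quotient depending on a term, hence not a type; vector spaces
  over the field \<open>'k\<close> are therefore given by a carrier set together with operations.
  Algebras need not be unital.\<close>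

record ('k, 'a) vspace =
  vcarrier :: "'a set"
  vzero    :: 'a
  vadd     :: "'a \<Rightarrow> 'a \<Rightarrow> 'a"
  vscale   :: "'k \<Rightarrow> 'a \<Rightarrow> 'a"

record ('k, 'a) algebra = "('k, 'a) vspace" +
  amult :: "'a \<Rightarrow> 'a \<Rightarrow> 'a"

definition is_vspace :: "('k::field, 'a, 'z) vspace_scheme \<Rightarrow> bool" where
  "is_vspace V \<longleftrightarrow>
     vzero V \<in> vcarrier V \<and>
     (\<forall>x\<in>vcarrier V. \<forall>y\<in>vcarrier V. vadd V x y \<in> vcarrier V) \<and>
     (\<forall>c. \<forall>x\<in>vcarrier V. vscale V c x \<in> vcarrier V) \<and>
     (\<forall>x\<in>vcarrier V. \<forall>y\<in>vcarrier V. \<forall>z\<in>vcarrier V.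
        vadd V (vadd V x y) z = vadd V x (vadd V y z)) \<and>
     (\<forall>x\<in>vcarrier V. \<forall>y\<in>vcarrier V. vadd V x y = vadd V y x) \<and>
     (\<forall>x\<in>vcarrier V. vadd V (vzero V) x = x) \<and>
     (\<forall>x\<in>vcarrier V. \<exists>y\<in>vcarrier V. vadd V y x = vzero V) \<and>
     (\<forall>c. \<forall>x\<in>vcarrier V. \<forall>y\<in>vcarrier V.
        vscale V c (vadd V x y) = vadd V (vscale V c x) (vscale V c y)) \<and>
     (\<forall>c d. \<forall>x\<in>vcarrier V. vscale V (c + d) x = vadd V (vscale V c x) (vscale V d x)) \<and>
     (\<forall>c d. \<forall>x\<in>vcarrier V. vscale V c (vscale V d x) = vscale V (c * d) x) \<and>
     (\<forall>x\<in>vcarrier V. vscale V 1 x = x)"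

definition vspace_iso ::
    "('k::field, 'a, 'y) vspace_scheme \<Rightarrow> ('k, 'b, 'z) vspace_scheme \<Rightarrow> ('a \<Rightarrow> 'b) \<Rightarrow> bool" where
  "vspace_iso V W f \<longleftrightarrow>
     is_vspace V \<and> is_vspace W \<and>
     bij_betw f (vcarrier V) (vcarrier W) \<and>
     (\<forall>x\<in>vcarrier V. \<forall>y\<in>vcarrier V. f (vadd V x y) = vadd W (f x) (f y)) \<and>
     (\<forall>c. \<forall>x\<in>vcarrier V. f (vscale V c x) = vscale W c (f x))"


section \<open>The free algebra\<close>

text \<open>Words form a monoid under concatenation. With this instance the type \<open>'x list \<Rightarrow>\<^sub>0 'k\<close> of
  finitely supported functions carries the convolution product and is the free unital
  \<open>'k\<close>-algebra over \<open>'x\<close>.\<close>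

instantiation list :: (type) monoid_add
begin

definition zero_list :: "'a list" where "zero_list = []"

definition plus_list :: "'a list \<Rightarrow> 'a list \<Rightarrow> 'a list" where "plus_list = (@)"

instance
  by standard (simp_all add: zero_list_def plus_list_def)

end

text \<open>\<open>Edge h i j\<close> stands for $h_{ij}$ and \<open>Ghost h i j\<close> for $h_{ij}^*$: in both cases \<open>i\<close> indexes
  \<open>s(h)\<close> and \<open>j\<close> indexes \<open>r(h)\<close>.\<close>

datatype ('v, 'e) letter = Vert 'v | Edge 'e nat nat | Ghost 'e nat nat

type_synonym ('v, 'e, 'k) free = "('v, 'e) letter list \<Rightarrow>\<^sub>0 'k"

definition edge_letters :: "('v, 'e) listed_hypergraph \<Rightarrow> ('v, 'e) letter set" where
  "edge_letters H =
     {Edge h i j | h i j. h \<in> hedges H \<and> i < size (src H h) \<and> j < size (rng H h)} \<union>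
     {Ghost h i j | h i j. h \<in> hedges H \<and> i < size (src H h) \<and> j < size (rng H h)}"

definition letters :: "('v, 'e) listed_hypergraph \<Rightarrow> ('v, 'e) letter set" where
  "letters H = Vert ` verts H \<union> edge_letters H"

definition mon :: "('v, 'e) letter list \<Rightarrow> ('v, 'e, 'k::field) free" where
  "mon w = Poly_Mapping.single w 1"

definition fscale :: "'k::field \<Rightarrow> ('v, 'e, 'k) free \<Rightarrow> ('v, 'e, 'k) free" where
  "fscale c p = Poly_Mapping.map ((*) c) p"

lemma lookup_fscale: "Poly_Mapping.lookup (fscale c p) w = c * Poly_Mapping.lookup p w"
  by (simp add: fscale_def Poly_Mapping.map.rep_eq when_def)

lemma vector_space_fscale: "vector_space fscale"
  by standard (auto intro!: poly_mapping_eqI simp: lookup_fscale lookup_add algebra_simps)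

text \<open>The nonunital free algebra on \<open>letters H\<close>: the empty word is excluded.\<close>

definition free_alg :: "('v, 'e) listed_hypergraph \<Rightarrow> ('v, 'e, 'k::field) free set" where
  "free_alg H = {p. \<forall>w\<in>Poly_Mapping.keys p. w \<noteq> [] \<and> set w \<subseteq> letters H}"


section \<open>The Leavitt path algebra\<close>

text \<open>Each equation of the presentation is represented by the difference of its two sides.\<close>

inductive_set lpa_rels :: "('v, 'e) listed_hypergraph \<Rightarrow> ('v, 'e, 'k::field) free set"
  for H :: "('v, 'e) listed_hypergraph" where
  vert_vert: "\<lbrakk>u \<in> verts H; v \<in> verts H\<rbrakk>
    \<Longrightarrow> mon [Vert u, Vert v] - (if u = v then mon [Vert u] else 0) \<in> lpa_rels H"
| src_edge: "\<lbrakk>h \<in> hedges H; i < size (src H h); j < size (rng H h)\<rbrakk>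
    \<Longrightarrow> mon [Vert (slist H h ! i), Edge h i j] - mon [Edge h i j] \<in> lpa_rels H"
| edge_rng: "\<lbrakk>h \<in> hedges H; i < size (src H h); j < size (rng H h)\<rbrakk>
    \<Longrightarrow> mon [Edge h i j, Vert (rlist H h ! j)] - mon [Edge h i j] \<in> lpa_rels H"
| rng_ghost: "\<lbrakk>h \<in> hedges H; i < size (src H h); j < size (rng H h)\<rbrakk>
    \<Longrightarrow> mon [Vert (rlist H h ! j), Ghost h i j] - mon [Ghost h i j] \<in> lpa_rels H"
| ghost_src: "\<lbrakk>h \<in> hedges H; i < size (src H h); j < size (rng H h)\<rbrakk>
    \<Longrightarrow> mon [Ghost h i j, Vert (slist H h ! i)] - mon [Ghost h i j] \<in> lpa_rels H"
| edge_ghost: "\<lbrakk>h \<in> hedges H; i < size (src H h); j < size (src H h)\<rbrakk>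
    \<Longrightarrow> (\<Sum>k<size (rng H h). mon [Edge h i k, Ghost h j k])
          - (if i = j then mon [Vert (slist H h ! i)] else 0) \<in> lpa_rels H"
| ghost_edge: "\<lbrakk>h \<in> hedges H; i < size (rng H h); j < size (rng H h)\<rbrakk>
    \<Longrightarrow> (\<Sum>k<size (src H h). mon [Ghost h k i, Edge h k j])
          - (if i = j then mon [Vert (rlist H h ! i)] else 0) \<in> lpa_rels H"

text \<open>Since \<open>free_alg H\<close> has no unit, closure under scalars does not follow from closure under
  multiplication and is part of the notion of an ideal of an algebra.\<close>

definition algebra_ideal ::
    "('v, 'e) listed_hypergraph \<Rightarrow> ('v, 'e, 'k::field) free set \<Rightarrow> bool" where
  "algebra_ideal H J \<longleftrightarrow>
     J \<subseteq> free_alg H \<and> module.subspace fscale J \<and>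
     (\<forall>a\<in>free_alg H. \<forall>x\<in>J. a * x \<in> J \<and> x * a \<in> J)"

definition lpa_ideal :: "('v, 'e) listed_hypergraph \<Rightarrow> ('v, 'e, 'k::field) free set" where
  "lpa_ideal H = \<Inter> {J. algebra_ideal H J \<and> lpa_rels H \<subseteq> J}"

definition lpa_class ::
    "('v, 'e) listed_hypergraph \<Rightarrow> ('v, 'e, 'k::field) free \<Rightarrow> ('v, 'e, 'k) free set" where
  "lpa_class H p = {p + x | x. x \<in> lpa_ideal H}"

definition LPA :: "('v, 'e) listed_hypergraph \<Rightarrow> ('k::field, ('v, 'e, 'k) free set) algebra" where
  "LPA H =
     \<lparr> vcarrier = lpa_class H ` free_alg H,
       vzero = lpa_ideal H,
       vadd = (\<lambda>A B. {a + b | a b. a \<in> A \<and> b \<in> B}),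
       vscale = (\<lambda>c A. {fscale c a + x | a x. a \<in> A \<and> x \<in> lpa_ideal H}),
       amult = (\<lambda>A B. {a * b + x | a b x. a \<in> A \<and> b \<in> B \<and> x \<in> lpa_ideal H}) \<rparr>"


text \<open>The operations on cosets are the ones induced from \<open>free_alg H\<close>.\<close>

lemma free_alg_mult:
  assumes "p \<in> free_alg H" "q \<in> free_alg H"
  shows "p * q \<in> free_alg H"
proof -
  have "w \<noteq> [] \<and> set w \<subseteq> letters H" if "w \<in> Poly_Mapping.keys (p * q)" for w
  proof -
    have "w \<in> {a + b | a b. a \<in> Poly_Mapping.keys p \<and> b \<in> Poly_Mapping.keys q}"
      using that keys_mult[of p q] by blast
    then obtain a b where "w = a @ b" "a \<in> Poly_Mapping.keys p" "b \<in> Poly_Mapping.keys q"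
      by (auto simp: plus_list_def)
    then show ?thesis
      using assms by (simp add: free_alg_def)
  qed
  then show ?thesis
    by (simp add: free_alg_def)
qed

lemma subspace_free_alg:
  fixes H :: "('v, 'e) listed_hypergraph"
  shows "module.subspace fscale (free_alg H :: ('v, 'e, 'k::field) free set)"
proof -
  interpret vector_space "fscale :: 'k \<Rightarrow> ('v, 'e, 'k) free \<Rightarrow> _" by (rule vector_space_fscale)
  show ?thesis
  proof (rule subspaceI)
    fix p q :: "('v, 'e, 'k) free" assume "p \<in> free_alg H" "q \<in> free_alg H"
    then show "p + q \<in> free_alg H"
      using Poly_Mapping.keys_add[of p q] by (auto simp: free_alg_def)
  next
    fix c :: 'k and p :: "('v, 'e, 'k) free" assume "p \<in> free_alg H"
    moreover have "Poly_Mapping.keys (fscale c p) \<subseteq> Poly_Mapping.keys p"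
      by (auto simp: in_keys_iff lookup_fscale)
    ultimately show "fscale c p \<in> free_alg H"
      by (auto simp: free_alg_def)
  qed (simp add: free_alg_def)
qed

lemma algebra_ideal_free_alg: "algebra_ideal H (free_alg H)"
  by (simp add: algebra_ideal_def subspace_free_alg free_alg_mult)

lemma lpa_rels_free_alg:
  fixes H :: "('v, 'e) listed_hypergraph"
  assumes "hypergraph H" "listings H"
  shows "(lpa_rels H :: ('v, 'e, 'k::field) free set) \<subseteq> free_alg H"
proof
  interpret vector_space "fscale :: 'k \<Rightarrow> ('v, 'e, 'k) free \<Rightarrow> _" by (rule vector_space_fscale)
  have mon: "(mon w :: ('v, 'e, 'k) free) \<in> free_alg H" if "w \<noteq> []" "set w \<subseteq> letters H" for w
    using that by (simp add: mon_def free_alg_def)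
  have zero: "(0 :: ('v, 'e, 'k) free) \<in> free_alg H"
    by (simp add: free_alg_def)
  have s: "slist H h ! i \<in> verts H" if "h \<in> hedges H" "i < size (src H h)" for h i
    using assms that unfolding hypergraph_def listings_def
    by (metis in_mono nth_mem set_mset_mset size_mset)
  have r: "rlist H h ! i \<in> verts H" if "h \<in> hedges H" "i < size (rng H h)" for h i
    using assms that unfolding hypergraph_def listings_def
    by (metis in_mono nth_mem set_mset_mset size_mset)
  note intros = subspace_diff[OF subspace_free_alg] subspace_sum[OF subspace_free_alg] mon
  fix x :: "('v, 'e, 'k) free" assume "x \<in> lpa_rels H"
  then show "x \<in> free_alg H"
    by cases (auto intro!: intros zero simp: letters_def edge_letters_def s r)
qed

lemma algebra_ideal_lpa_ideal:
  fixes H :: "('v, 'e) listed_hypergraph"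
  assumes "hypergraph H" "listings H"
  shows "algebra_ideal H (lpa_ideal H :: ('v, 'e, 'k::field) free set)"
proof -
  interpret vector_space "fscale :: 'k \<Rightarrow> ('v, 'e, 'k) free \<Rightarrow> _" by (rule vector_space_fscale)
  have "(lpa_ideal H :: ('v, 'e, 'k) free set) \<subseteq> free_alg H"
    using algebra_ideal_free_alg[of H] lpa_rels_free_alg[OF assms]
    by (auto simp: lpa_ideal_def)
  moreover have "subspace (lpa_ideal H :: ('v, 'e, 'k) free set)"
    unfolding lpa_ideal_def by (intro subspace_Inter) (simp add: algebra_ideal_def)
  ultimately show ?thesis
    by (auto simp: algebra_ideal_def lpa_ideal_def)
qed

lemma
  fixes H :: "('v, 'e) listed_hypergraph" and c :: "'k::field" and p q :: "('v, 'e, 'k) free"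
  assumes "hypergraph H" "listings H"
  shows vzero_LPA: "vzero (LPA H) = lpa_class H (0 :: ('v, 'e, 'k) free)"
    and vadd_LPA: "vadd (LPA H) (lpa_class H p) (lpa_class H q) = lpa_class H (p + q)"
    and vscale_LPA: "vscale (LPA H) c (lpa_class H p) = lpa_class H (fscale c p)"
    and amult_LPA: "\<lbrakk>p \<in> free_alg H; q \<in> free_alg H\<rbrakk>
      \<Longrightarrow> amult (LPA H) (lpa_class H p) (lpa_class H q) = lpa_class H (p * q)"
proof -
  interpret vector_space "fscale :: 'k \<Rightarrow> ('v, 'e, 'k) free \<Rightarrow> _" by (rule vector_space_fscale)
  have I: "subspace (lpa_ideal H :: ('v, 'e, 'k) free set)"
      "(lpa_ideal H :: ('v, 'e, 'k) free set) \<subseteq> free_alg H"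
    and M: "\<And>a x :: ('v, 'e, 'k) free.
      \<lbrakk>a \<in> free_alg H; x \<in> lpa_ideal H\<rbrakk> \<Longrightarrow> a * x \<in> lpa_ideal H \<and> x * a \<in> lpa_ideal H"
    using algebra_ideal_lpa_ideal[OF assms] by (auto simp: algebra_ideal_def)
  note [simp] = subspace_0[OF I(1)] subspace_add[OF I(1)] subspace_scale[OF I(1)]
  show "vzero (LPA H) = lpa_class H (0 :: ('v, 'e, 'k) free)"
    by (simp add: LPA_def lpa_class_def)
  show "vadd (LPA H) (lpa_class H p) (lpa_class H q) = lpa_class H (p + q)" (is "?L = ?R")
  proof
    show "?L \<subseteq> ?R"
    proof
      fix y assume "y \<in> ?L"
      then obtain a b where "y = (p + a) + (q + b)" "a \<in> lpa_ideal H" "b \<in> lpa_ideal H"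
        by (auto simp: LPA_def lpa_class_def)
      then have "y = (p + q) + (a + b)" "a + b \<in> lpa_ideal H"
        by (simp_all add: algebra_simps)
      then show "y \<in> ?R" by (auto simp: lpa_class_def)
    qed
    show "?R \<subseteq> ?L"
    proof
      fix y assume "y \<in> ?R"
      then obtain x where "y = (p + 0) + (q + x)" "x \<in> lpa_ideal H"
        by (auto simp: lpa_class_def algebra_simps)
      then show "y \<in> ?L" 
        unfolding LPA_def lpa_class_def using subspace_0[OF I(1)] by fastforce
    qed
  qed
  show "vscale (LPA H) c (lpa_class H p) = lpa_class H (fscale c p)" (is "?L = ?R")
  proof
    show "?L \<subseteq> ?R"
    proof
      fix y assume "y \<in> ?L"
      then obtain a x where "y = fscale c (p + a) + x" "a \<in> lpa_ideal H" "x \<in> lpa_ideal H"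
        by (auto simp: LPA_def lpa_class_def)
      then have "y = fscale c p + (fscale c a + x)" "fscale c a + x \<in> lpa_ideal H"
        by (simp_all add: scale_right_distrib algebra_simps)
      then show "y \<in> ?R" by (auto simp: lpa_class_def)
    qed
    show "?R \<subseteq> ?L"
    proof
      fix y assume "y \<in> ?R"
      then obtain x where "y = fscale c (p + 0) + x" "x \<in> lpa_ideal H"
        by (auto simp: lpa_class_def)
      then show "y \<in> ?L" 
        unfolding LPA_def lpa_class_def using subspace_0[OF I(1)] by fastforce
    qed
  qed
  assume p: "p \<in> free_alg H" and q: "q \<in> free_alg H"
  show "amult (LPA H) (lpa_class H p) (lpa_class H q) = lpa_class H (p * q)" (is "?L = ?R")
  proof
    show "?L \<subseteq> ?R"
    proof
      fix y assume "y \<in> ?L"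
      then obtain a b x where y: "y = (p + a) * (q + b) + x"
        and abx: "a \<in> lpa_ideal H" "b \<in> lpa_ideal H" "x \<in> lpa_ideal H"
        by (auto simp: LPA_def lpa_class_def)
      have "p * b \<in> lpa_ideal H" "a * q \<in> lpa_ideal H" "a * b \<in> lpa_ideal H"
        using abx p q M I(2) by blast+
      then have "y = p * q + (p * b + a * q + a * b + x)" "p * b + a * q + a * b + x \<in> lpa_ideal H"
        using y abx by (simp_all add: algebra_simps)
      then show "y \<in> ?R" unfolding lpa_class_def by blast
    qed
    show "?R \<subseteq> ?L"
    proof
      fix y assume "y \<in> ?R"
      then obtain x where "y = (p + 0) * (q + 0) + x" "x \<in> lpa_ideal H"
        by (auto simp: lpa_class_def)
      then show "y \<in> ?L"
        
        unfolding LPA_def lpa_class_def using subspace_0[OF I(1)] by fastforce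
    qed
  qed
qed


section \<open>Nod-paths and normal forms\<close>

text \<open>Source and range in the directed graph whose edges are \<open>edge_letters H\<close>. The clauses for
  vertices are never used for a d-path.\<close>

fun esource :: "('v, 'e) listed_hypergraph \<Rightarrow> ('v, 'e) letter \<Rightarrow> 'v" where
  "esource H (Vert v) = v"
| "esource H (Edge h i j) = slist H h ! i"
| "esource H (Ghost h i j) = rlist H h ! j"

fun erange :: "('v, 'e) listed_hypergraph \<Rightarrow> ('v, 'e) letter \<Rightarrow> 'v" where
  "erange H (Vert v) = v"
| "erange H (Edge h i j) = rlist H h ! j"
| "erange H (Ghost h i j) = slist H h ! i"

definition d_path :: "('v, 'e) listed_hypergraph \<Rightarrow> ('v, 'e) letter list \<Rightarrow> bool" where
  "d_path H w \<longleftrightarrow>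
     (\<exists>v\<in>verts H. w = [Vert v]) \<or>
     (w \<noteq> [] \<and> set w \<subseteq> edge_letters H \<and> successively (\<lambda>x y. erange H x = esource H y) w)"

definition forbidden :: "('v, 'e) listed_hypergraph \<Rightarrow> ('v, 'e) letter list set" where
  "forbidden H =
     {[Edge h i 0, Ghost h j 0] | h i j.
        h \<in> hedges H \<and> i < size (src H h) \<and> j < size (src H h)} \<union>
     {[Ghost h 0 i, Edge h 0 j] | h i j.
        h \<in> hedges H \<and> i < size (rng H h) \<and> j < size (rng H h)}"

definition nod_path :: "('v, 'e) listed_hypergraph \<Rightarrow> ('v, 'e) letter list \<Rightarrow> bool" where
  "nod_path H w \<longleftrightarrow> d_path H w \<and> (\<forall>u\<in>forbidden H. \<not> sublist u w)"

definition nod_space ::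
    "('v, 'e) listed_hypergraph \<Rightarrow> ('k::field, ('v, 'e, 'k) free) vspace" where
  "nod_space H =
     \<lparr> vcarrier = module.span fscale {mon w | w. nod_path H w},
       vzero = 0, vadd = (+), vscale = fscale \<rparr>"

definition normal_rep ::
    "('v, 'e) listed_hypergraph \<Rightarrow> ('v, 'e, 'k::field) free set \<Rightarrow> ('v, 'e, 'k) free \<Rightarrow> bool" where
  "normal_rep H a p \<longleftrightarrow>
     p \<in> free_alg H \<and> lpa_class H p = a \<and> p \<in> vcarrier (nod_space H)"

definition NF ::
    "('v, 'e) listed_hypergraph \<Rightarrow> ('v, 'e, 'k::field) free set \<Rightarrow> ('v, 'e, 'k) free" where
  "NF H a = (THE p. normal_rep H a p)"

end

theory Submission
  imports Defs
begin

text \<open>The relations, read as rewrite rules that contract mismatched, vertex-containing and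
  forbidden words, define a right action of the free algebra on the span of the nod-paths. The
  defining relations act as zero, so the whole ideal does. A nod-path \<open>w\<close> with source \<open>v\<close> sends
  the trivial path \<open>v\<close> to \<open>w\<close>, and all other trivial paths to 0; hence no nonzero combination of
  nod-paths lies in the ideal. Conversely, multiplying a nod-path by a letter agrees with
  the action modulo the ideal, so by induction on the length every word is congruent to
  a combination of nod-paths.\<close>

section \<open>Linear algebra on the free algebra\<close>

text \<open>The last two families of relations say that the matrix of the \<open>Edge h i j\<close>
  and the transposed matrix of the \<open>Ghost h i j\<close> are inverse to each other. Each
  relation is solved for the summand with inner index 0, and the products occurring there are
  exactly the forbidden words. All correction terms have inner index at least 1, which is why a
  single contraction already gives a normal form. The obstacle is an overlap such as
  \<open>Edge h l 0\<close>, \<open>Ghost h 0 0\<close>, \<open>Edge h 0 j\<close>, where both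
  adjacent pairs are forbidden. Confluence for arbitrary words is never discussed: an action
  consumes letters from left to right, so the overlap shows up only when a relation acts on a path
  whose last letter forms a forbidden word with the first letter of the relation. There both
  contractions produce a double sum over the two inner indices, and exchanging the order of
  summation reduces it to the case without overlap.\<close>

interpretation fs: vector_space fscale
  by (rule vector_space_fscale)

lemma fscale_single: "fscale c (Poly_Mapping.single w d) = Poly_Mapping.single w (c * d)"
  by (rule poly_mapping_eqI) (simp add: lookup_fscale lookup_single when_def)

text \<open>The ambient type also contains the empty word and letters foreign to \<open>H\<close>;
  linear algebra is done on all of it, and the restriction to \<open>free_alg H\<close> comes later.
  There is no zero case because 0 is a multiple of any word.\<close>

lemma free_induct [case_names mon add scale]:
  assumes mon: "\<And>w. P (mon w)"
    and add: "\<And>p q. P p \<Longrightarrow> P q \<Longrightarrow> P (p + q)"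
    and scale: "\<And>c p. P p \<Longrightarrow> P (fscale c p)"
  shows "P p"
proof (induction p rule: update_induct)
  case const
  have "P (fscale 0 (mon undefined))"
    by (intro scale mon)
  then show ?case
    by simp
next
  case (update f a b)
  have "Poly_Mapping.update a b f = f + fscale b (mon a)"
    using update(1)
    by (intro poly_mapping_eqI)
       (auto simp: lookup_update lookup_add mon_def fscale_single lookup_single when_def in_keys_iff)
  then show ?case
    by (simp only: add scale mon update)
qed

lemma mon_mult: "mon u * mon w = mon (u @ w)"
  by (simp add: mon_def mult_single plus_list_def)

lemma fscale_mult_left:
  fixes p q :: "('v, 'e, 'k::field) free"
  shows "fscale c p * q = fscale c (p * q)"
proof -
  \<comment> \<open>The empty word is the unit, so scaling is left multiplication by a constant and
    the claim becomes associativity.\<close>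
  have eq: "fscale c r = Poly_Mapping.single [] c * r" for r :: "('v, 'e, 'k) free"
  proof (induction r rule: update_induct)
    case (update f a b)
    have "Poly_Mapping.update a b f = f + Poly_Mapping.single a b"
      using update(1)
      by (intro poly_mapping_eqI) (auto simp: lookup_update lookup_add lookup_single when_def in_keys_iff)
    then show ?case
      using update by (simp add: fs.scale_right_distrib fscale_single distrib_left mult_single plus_list_def)
  qed simp
  show ?thesis
    by (simp add: eq mult.assoc)
qed

text \<open>Here the constant would have to be moved past \<open>p\<close>, so the claim is checked
  on words in both factors instead.\<close>

lemma fscale_mult_right: "p * fscale c q = fscale c (p * q)"
proof (induction p rule: free_induct)
  case (mon w)
  show ?case
  proof (induction q arbitrary: c rule: free_induct)
    case (mon u)
    show ?case
      by (simp add: mon_def fscale_single mult_single)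
  next
    case (scale d p)
    then show ?case
      by simp
  qed (simp add: fs.scale_right_distrib distrib_left)
qed (simp_all add: fs.scale_right_distrib distrib_right fscale_mult_left fs.scale_left_commute)

definition lext ::
  "(('v, 'e) letter list \<Rightarrow> ('v, 'e, 'k::field) free) \<Rightarrow> ('v, 'e, 'k) free \<Rightarrow> ('v, 'e, 'k) free" where
  "lext f p = (\<Sum>w\<in>Poly_Mapping.keys p. fscale (Poly_Mapping.lookup p w) (f w))"

lemma lext_superset:
  assumes "finite S" "Poly_Mapping.keys p \<subseteq> S"
  shows "lext f p = (\<Sum>w\<in>S. fscale (Poly_Mapping.lookup p w) (f w))"
  unfolding lext_def using assms by (intro sum.mono_neutral_left) (auto simp: in_keys_iff)

lemma lext_mon [simp]: "lext f (mon w) = f w"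
  by (simp add: lext_def mon_def)

interpretation lext: module_hom fscale fscale "lext f"
  for f :: "('v, 'e) letter list \<Rightarrow> ('v, 'e, 'k::field) free"
proof (intro module_hom.intro fs.module_axioms module_hom_axioms.intro)
  fix p q :: "('v, 'e, 'k) free" and c
  let ?S = "Poly_Mapping.keys p \<union> Poly_Mapping.keys q \<union> Poly_Mapping.keys (p + q)"
  have "lext f r = (\<Sum>w\<in>?S. fscale (Poly_Mapping.lookup r w) (f w))" if "r \<in> {p, q, p + q}" for r
    using that by (intro lext_superset) auto
  then show "lext f (p + q) = lext f p + lext f q"
    by (simp add: lookup_add fs.scale_left_distrib sum.distrib)
  have "Poly_Mapping.keys (fscale c p) \<subseteq> Poly_Mapping.keys p"
    by (auto simp: in_keys_iff lookup_fscale)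
  then show "lext f (fscale c p) = fscale c (lext f p)"
    by (simp add: lext_superset[of "Poly_Mapping.keys p"] lookup_fscale fs.scale_sum_right)
qed

lemma lext_mon_id: "lext mon p = p"
  by (induction p rule: free_induct) (simp_all add: lext.add lext.scale)

section \<open>Right actions of the free algebra generated by operators for the letters\<close>

definition ract ::
  "(('v, 'e) letter \<Rightarrow> ('v, 'e, 'k::field) free \<Rightarrow> ('v, 'e, 'k) free) \<Rightarrow>
     ('v, 'e, 'k) free \<Rightarrow> ('v, 'e, 'k) free \<Rightarrow> ('v, 'e, 'k) free" where
  "ract R q p = lext (\<lambda>u. foldl (\<lambda>q x. R x q) q u) p"

lemma ract_mon: "ract R q (mon u) = foldl (\<lambda>q x. R x q) q u"
  by (simp add: ract_def)

interpretation ract_right: module_hom fscale fscale "ract R q" for R q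
  unfolding ract_def by (rule lext.module_hom_axioms)

lemma module_hom_ract_left:
  assumes "\<And>x. module_hom fscale fscale (R x)"
  shows "module_hom fscale fscale (\<lambda>q. ract R q p)"
proof (intro module_hom.intro fs.module_axioms module_hom_axioms.intro)
  fix a b and c
  have "foldl (\<lambda>q x. R x q) (a + b) u = foldl (\<lambda>q x. R x q) a u + foldl (\<lambda>q x. R x q) b u"
    "foldl (\<lambda>q x. R x q) (fscale c a) u = fscale c (foldl (\<lambda>q x. R x q) a u)" for u
    by (induction u arbitrary: a b)
       (simp_all add: module_hom.add[OF assms] module_hom.scale[OF assms])
  then show "ract R (a + b) p = ract R a p + ract R b p"
    and "ract R (fscale c a) p = fscale c (ract R a p)"
    by (simp_all add: ract_def lext_def fs.scale_right_distrib sum.distrib fs.scale_sum_right mult.commute[of _ c])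
qed

text \<open>This is the universal property of the free algebra: linear operators, one for each
  letter, define a right module. On words it is \<open>foldl\<close> over an append; linearity of
  the operators extends it to sums in \<open>a\<close>.\<close>

lemma ract_mult:
  assumes "\<And>x. module_hom fscale fscale (R x)"
  shows "ract R q (a * b) = ract R (ract R q a) b"
proof (induction a rule: free_induct)
  case (mon w)
  show ?case
    by (induction b rule: free_induct)
       (simp_all add: mon_mult ract_mon distrib_left ract_right.add fscale_mult_right ract_right.scale)
next
  case (add p p')
  then show ?case
    by (simp add: distrib_right ract_right.add module_hom.add[OF module_hom_ract_left[OF assms]])
next
  case (scale c p)
  then show ?case
    by (simp add: fscale_mult_left ract_right.scale module_hom.scale[OF module_hom_ract_left[OF assms]])
qed


section \<open>Rooted nod-paths and the action of the letters\<close>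

text \<open>A uniform notation for $h_{ij}$ and $h_{ji}^*$ that makes the two families of
  forbidden words, and the last two families of relations, instances of one another.\<close>

definition bi :: "bool \<Rightarrow> 'e \<Rightarrow> nat \<Rightarrow> nat \<Rightarrow> ('v, 'e) letter" where
  "bi b h i j = (if b then Edge h i j else Ghost h j i)"

definition ends :: "('v, 'e) listed_hypergraph \<Rightarrow> bool \<Rightarrow> 'e \<Rightarrow> 'v list" where
  "ends H b = (if b then slist H else rlist H)"

lemma bi_eq_iff [simp]: "bi b h i j = bi b' h' i' j' \<longleftrightarrow> b = b' \<and> h = h' \<and> i = i' \<and> j = j'"
  by (auto simp: bi_def)

lemma bi_neq_Vert [simp]: "bi b h i j \<noteq> Vert v" "Vert v \<noteq> bi b h i j"
  by (auto simp: bi_def)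

lemma esource_bi [simp]: "esource H (bi b h i j) = ends H b h ! i"
  and erange_bi [simp]: "erange H (bi b h i j) = ends H (\<not> b) h ! j"
  by (auto simp: bi_def ends_def)

text \<open>The forbidden product is replaced using its relation, with \<open>u\<close> multiplied
  on the left. The diagonal term is \<open>mon u\<close> without a vertex letter, because in the
  intended use \<open>u\<close> already ends at that vertex.\<close>

definition contract ::
  "('v, 'e) listed_hypergraph \<Rightarrow> ('v, 'e) letter list \<Rightarrow> ('v, 'e) letter \<Rightarrow> ('v, 'e) letter \<Rightarrow>
     ('v, 'e, 'k::field) free" where
  "contract H u x y =
     (case (x, y) of
        (Edge h i k, Ghost h' j k') \<Rightarrow>
          if h = h' \<and> k = 0 \<and> k' = 0
          then (if i = j then mon u else 0)
               - (\<Sum>k = 1..<length (rlist H h). mon (u @ [Edge h i k, Ghost h j k]))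
          else mon (u @ [x, y])
      | (Ghost h k i, Edge h' k' j) \<Rightarrow>
          if h = h' \<and> k = 0 \<and> k' = 0
          then (if i = j then mon u else 0)
               - (\<Sum>k = 1..<length (slist H h). mon (u @ [Ghost h k i, Edge h k j]))
          else mon (u @ [x, y])
      | _ \<Rightarrow> mon (u @ [x, y]))"

lemma contract_bi:
  "contract H u (bi b h i 0) (bi (\<not> b) h 0 j) =
     (if i = j then mon u else 0)
     - (\<Sum>k = 1..<length (ends H (\<not> b) h). mon (u @ [bi b h i k, bi (\<not> b) h k j]))"
  by (auto simp: contract_def bi_def ends_def)

lemma contract_other:
  assumes "\<nexists>b h i j. x = bi b h i 0 \<and> y = bi (\<not> b) h 0 j"
  shows "contract H u x y = mon (u @ [x, y])"
proof -
  have "\<forall>h i j. \<not> (x = Edge h i 0 \<and> y = Ghost h j 0)" "\<forall>h i j. \<not> (x = Ghost h 0 i \<and> y = Edge h 0 j)"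
    using assms by (auto simp: bi_def all_bool_eq)
  then show ?thesis
    by (auto simp: contract_def split: letter.splits)
qed

text \<open>For a nod-path \<open>w\<close>, the normal form of the product of \<open>w\<close> with the letter \<open>x\<close>: contracting a
  forbidden word at the end creates no new forbidden words, so a single step suffices.\<close>

definition act ::
  "('v, 'e) listed_hypergraph \<Rightarrow> ('v, 'e) letter list \<Rightarrow> ('v, 'e) letter \<Rightarrow> ('v, 'e, 'k::field) free" where
  "act H w x =
     (if erange H (last w) \<noteq> esource H x then 0
      else case x of Vert _ \<Rightarrow> mon w | _ \<Rightarrow> contract H (butlast w) (last w) x)"

definition letter_act ::
  "('v, 'e) listed_hypergraph \<Rightarrow> ('v, 'e) letter \<Rightarrow> ('v, 'e, 'k::field) free \<Rightarrow> ('v, 'e, 'k) free" where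
  "letter_act H x = lext (\<lambda>w. act H w x)"

lemma letter_act_mon [simp]: "letter_act H x (mon w) = act H w x"
  by (simp add: letter_act_def)

interpretation letter_act: module_hom fscale fscale "letter_act H x" for H x
  unfolding letter_act_def by (rule lext.module_hom_axioms)

interpretation ract_left: module_hom fscale fscale "\<lambda>q. ract (letter_act H) q p" for H p
  by (rule module_hom_ract_left) (rule letter_act.module_hom_axioms)

text \<open>Nod-paths are encoded with their source vertex prepended, so that a trivial path is not
  an exceptional case.\<close>

definition rooted :: "('v, 'e) listed_hypergraph \<Rightarrow> ('v, 'e) letter list \<Rightarrow> bool" where
  "rooted H w \<longleftrightarrow>
     w \<noteq> [] \<and> hd w \<in> Vert ` verts H \<and> set (tl w) \<subseteq> edge_letters H \<and>
     successively (\<lambda>x y. erange H x = esource H y \<and> [x, y] \<notin> forbidden H) w"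

definition rooted_space :: "('v, 'e) listed_hypergraph \<Rightarrow> ('v, 'e, 'k::field) free set" where
  "rooted_space H = fs.span {mon w | w. rooted H w}"

lemma rooted_Vert: "v \<in> verts H \<Longrightarrow> rooted H [Vert v]"
  by (simp add: rooted_def)

lemma rooted_nonempty [simp]: "rooted H w \<Longrightarrow> w \<noteq> []"
  by (auto simp: rooted_def)

text \<open>Since \<open>erange H (Vert v) = v\<close>, the root counts as an ordinary last letter,
  and one criterion covers trivial and nontrivial paths.\<close>

lemma rooted_snoc:
  assumes "w \<noteq> []"
  shows "rooted H (w @ [x]) \<longleftrightarrow>
    rooted H w \<and> x \<in> edge_letters H \<and> erange H (last w) = esource H x \<and> [last w, x] \<notin> forbidden H"
  using assms by (auto simp: rooted_def successively_append_iff)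

lemma mon_rooted_space: "rooted H w \<Longrightarrow> mon w \<in> rooted_space H"
  unfolding rooted_space_def by (intro fs.span_base) auto

section \<open>Letters and forbidden words of a fixed hypergraph\<close>

locale leavitt =
  fixes H :: "('v, 'e) listed_hypergraph"
  assumes hypergraph: "hypergraph H" and listings: "listings H"
begin

abbreviation width :: "bool \<Rightarrow> 'e \<Rightarrow> nat" where
  "width b h \<equiv> length (ends H b h)"

lemma size_src: "h \<in> hedges H \<Longrightarrow> size (src H h) = width True h"
  and size_rng: "h \<in> hedges H \<Longrightarrow> size (rng H h) = width False h"
  using listings by (simp_all add: listings_def ends_def flip: size_mset)

lemma width_pos: "h \<in> hedges H \<Longrightarrow> 0 < width b h"
  using hypergraph listings
  by (cases b) (auto simp: hypergraph_def listings_def ends_def)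

lemma ends_in_verts: "h \<in> hedges H \<Longrightarrow> i < width b h \<Longrightarrow> ends H b h ! i \<in> verts H"
  using hypergraph listings
  by (cases b) (auto simp: hypergraph_def listings_def ends_def dest!: nth_mem, (metis in_mono set_mset_mset)+)

lemma edge_letters_iff:
  "x \<in> edge_letters H \<longleftrightarrow> (\<exists>b h i j. h \<in> hedges H \<and> i < width b h \<and> j < width (\<not> b) h \<and> x = bi b h i j)"
  (is "?L \<longleftrightarrow> ?R")
proof
  assume ?L
  then show ?R
    unfolding edge_letters_def
  proof (elim UnE CollectE exE conjE)
    fix h i j assume *: "x = Edge h i j" "h \<in> hedges H" "i < size (src H h)" "j < size (rng H h)"
    then show ?R
      by (intro exI[of _ True] exI[of _ h] exI[of _ i] exI[of _ j])
         (simp add: size_src size_rng bi_def)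
  next
    fix h i j assume *: "x = Ghost h i j" "h \<in> hedges H" "i < size (src H h)" "j < size (rng H h)"
    then show ?R
      by (intro exI[of _ False] exI[of _ h] exI[of _ j] exI[of _ i])
         (simp add: size_src size_rng bi_def)
  qed
next
  assume ?R
  then show ?L
    by (auto simp: edge_letters_def bi_def size_src size_rng all_bool_eq ex_bool_eq)
qed

lemma bi_edge_letters [simp]:
  "bi b h i j \<in> edge_letters H \<longleftrightarrow> h \<in> hedges H \<and> i < width b h \<and> j < width (\<not> b) h"
  by (auto simp: edge_letters_iff)

lemma Vert_edge_letters [simp]: "Vert v \<notin> edge_letters H"
  by (auto simp: edge_letters_iff)

lemma letters_cases [consumes 1, case_names Vert bi]:
  assumes "x \<in> letters H"
  obtains v where "v \<in> verts H" "x = Vert v"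
  | b h i j where "h \<in> hedges H" "i < width b h" "j < width (\<not> b) h" "x = bi b h i j"
  using assms by (auto simp: letters_def edge_letters_iff)

lemma forbidden_iff:
  "u \<in> forbidden H \<longleftrightarrow>
     (\<exists>b h i j. h \<in> hedges H \<and> i < width b h \<and> j < width b h \<and> u = [bi b h i 0, bi (\<not> b) h 0 j])"
  (is "?L \<longleftrightarrow> ?R")
proof
  assume ?L
  then show ?R
    unfolding forbidden_def
  proof (elim UnE CollectE exE conjE)
    fix h i j assume *: "u = [Edge h i 0, Ghost h j 0]" "h \<in> hedges H" "i < size (src H h)" "j < size (src H h)"
    then show ?R
      by (intro exI[of _ True] exI[of _ h] exI[of _ i] exI[of _ j])
         (simp add: size_src size_rng bi_def)
  next
    fix h i j assume *: "u = [Ghost h 0 i, Edge h 0 j]" "h \<in> hedges H" "i < size (rng H h)" "j < size (rng H h)"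
    then show ?R
      by (intro exI[of _ False] exI[of _ h] exI[of _ i] exI[of _ j])
         (simp add: size_src size_rng bi_def)
  qed
next
  assume ?R
  then show ?L
    by (auto simp: forbidden_def bi_def size_src size_rng ex_bool_eq)
qed

lemma forbidden_bi_iff:
  "[y, bi c h m k] \<in> forbidden H \<longleftrightarrow>
     h \<in> hedges H \<and> m = 0 \<and> k < width (\<not> c) h \<and> (\<exists>i < width (\<not> c) h. y = bi (\<not> c) h i 0)"
  by (auto simp: forbidden_iff)

lemma edge_letters_subset: "x \<in> edge_letters H \<Longrightarrow> x \<in> letters H"
  by (simp add: letters_def)

text \<open>\<open>contract\<close> tests only hyperedges and zero indices, whereas
  \<open>forbidden H\<close> also bounds the indices; for letters of \<open>H\<close> the bounds
  hold automatically.\<close>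

lemma contract_not_forbidden:
  assumes "x \<in> letters H" "y \<in> letters H" "[x, y] \<notin> forbidden H"
  shows "contract H u x y = mon (u @ [x, y])"
proof (rule contract_other, clarsimp)
  fix b h i j assume "x = bi b h i 0" "y = bi (\<not> b) h 0 j"
  with assms show False
    by (auto simp: forbidden_iff letters_def)
qed

lemma rooted_last: "rooted H w \<Longrightarrow> last w \<in> letters H"
proof -
  assume w: "rooted H w"
  have "last w \<in> insert (hd w) (set (tl w))"
    using rooted_nonempty[OF w] by (cases w) auto
  with w show "last w \<in> letters H"
    by (auto simp: rooted_def letters_def)
qed

section \<open>One letter acting on a rooted path\<close>

lemma act_Vert: "act H w (Vert v) = (if erange H (last w) = v then mon w else 0)"
  by (simp add: act_def)

lemma act_mismatch: "erange H (last w) \<noteq> esource H x \<Longrightarrow> act H w x = 0"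
  by (simp add: act_def)

lemma act_edge:
  assumes "x \<in> edge_letters H" "erange H (last w) = esource H x"
  shows "act H w x = contract H (butlast w) (last w) x"
  using assms by (cases x) (auto simp: act_def)

lemma act_append:
  assumes "rooted H (w @ [x])" "w \<noteq> []"
  shows "act H w x = mon (w @ [x])"
proof -
  have "act H w x = contract H (butlast w) (last w) x"
    using assms by (simp add: rooted_snoc act_edge)
  also have "\<dots> = mon (butlast w @ [last w, x])"
    using assms by (intro contract_not_forbidden) (auto simp: rooted_snoc rooted_last intro: edge_letters_subset)
  also have "butlast w @ [last w, x] = w @ [x]"
    using assms(2) append_butlast_last_id[of w] by (metis append.assoc append_Cons append_Nil)
  finally show ?thesis .
qed

text \<open>Neither the source of the appended letter nor the obstruction to appending it depends on
  its second index, so one unobstructed choice \<open>k'\<close> licenses every \<open>k\<close>.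
  Hence the summands of a relation can be appended all together or not at all.\<close>

lemma rooted_snoc_bi:
  assumes "rooted H w" "h \<in> hedges H" "i < width b h" "k < width (\<not> b) h"
    and "erange H (last w) = ends H b h ! i"
    and "[last w, bi b h i k'] \<notin> forbidden H" "k' < width (\<not> b) h"
  shows "rooted H (w @ [bi b h i k])"
  using assms by (auto simp: rooted_snoc forbidden_bi_iff)

lemma act_contract:
  assumes "rooted H (w @ [bi b h i 0])" "w \<noteq> []" "j < width b h"
  shows "act H (w @ [bi b h i 0]) (bi (\<not> b) h 0 j) =
     (if i = j then mon w else 0)
     - (\<Sum>k = 1..<width (\<not> b) h. mon (w @ [bi b h i k, bi (\<not> b) h k j]))"
  using assms by (simp add: act_edge rooted_snoc contract_bi)

lemma rooted_sibling:
  assumes "rooted H (w @ [bi b h i 0])" "w \<noteq> []" "k < width (\<not> b) h"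
  shows "rooted H (w @ [bi b h i k])"
  using assms by (intro rooted_snoc_bi[where k' = 0]) (auto simp: rooted_snoc)

text \<open>A forbidden word has both inner indices 0, so \<open>0 < k\<close> makes the new pair
  harmless. This is why the correction terms of a contraction are already in normal form.\<close>

lemma rooted_sibling2:
  assumes "rooted H (w @ [bi b h i 0])" "w \<noteq> []" "j < width b h" "k < width (\<not> b) h" "0 < k"
  shows "rooted H (w @ [bi b h i k, bi (\<not> b) h k j])"
proof -
  have "rooted H ((w @ [bi b h i k]) @ [bi (\<not> b) h k j])"
    using assms rooted_sibling[OF assms(1,2,4)]
    by (subst rooted_snoc) (auto simp: rooted_snoc forbidden_bi_iff)
  then show ?thesis
    by simp
qed

section \<open>The inverse-matrix relations acting on rooted paths\<close>

lemma relation_act_not_forbidden: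
  assumes w: "rooted H w" and h: "h \<in> hedges H" "i < width b h" "j < width b h"
    and e: "erange H (last w) = ends H b h ! i" "[last w, bi b h i 0] \<notin> forbidden H"
  shows "(\<Sum>k<width (\<not> b) h. letter_act H (bi (\<not> b) h k j)
      (letter_act H (bi b h i k) (mon w :: ('v, 'e, 'k::field) free)))
    = (if i = j then mon w else 0)"
proof -
  let ?m = "mon :: _ \<Rightarrow> ('v, 'e, 'k) free"
  have r: "rooted H (w @ [bi b h i 0])"
    using assms width_pos[OF h(1), of "\<not> b"] by (intro rooted_snoc_bi[where k' = 0]) auto
  have ne: "w \<noteq> []"
    using w by simp
  have 1: "letter_act H (bi b h i k) (?m w) = ?m (w @ [bi b h i k])" if "k < width (\<not> b) h" for k
    using rooted_sibling[OF r ne that] ne by (simp add: act_append)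
  have 2: "letter_act H (bi (\<not> b) h k j) (?m (w @ [bi b h i k])) = ?m (w @ [bi b h i k, bi (\<not> b) h k j])"
    if "k < width (\<not> b) h" "0 < k" for k
    using rooted_sibling2[OF r ne h(3) that] act_append[of "w @ [bi b h i k]"] by simp
  \<comment> \<open>Splitting off the summand 0 is possible because sources and ranges of hyperedges
    are nonempty.\<close>
  have 0: "0 < width (\<not> b) h" "{..<width (\<not> b) h} = insert 0 {1..<width (\<not> b) h}"
    using width_pos[OF h(1), of "\<not> b"] by auto
  have "(\<Sum>k<width (\<not> b) h. letter_act H (bi (\<not> b) h k j) (letter_act H (bi b h i k) (?m w))) =
      (\<Sum>k<width (\<not> b) h. letter_act H (bi (\<not> b) h k j) (?m (w @ [bi b h i k])))"
    by (intro sum.cong refl) (simp only: 1 lessThan_iff)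
  also have "\<dots> = letter_act H (bi (\<not> b) h 0 j) (?m (w @ [bi b h i 0])) +
      (\<Sum>k = 1..<width (\<not> b) h. letter_act H (bi (\<not> b) h k j) (?m (w @ [bi b h i k])))"
    unfolding 0(2) by (subst sum.insert) auto
  also have "(\<Sum>k = 1..<width (\<not> b) h. letter_act H (bi (\<not> b) h k j) (?m (w @ [bi b h i k]))) =
      (\<Sum>k = 1..<width (\<not> b) h. ?m (w @ [bi b h i k, bi (\<not> b) h k j]))"
    by (intro sum.cong refl 2) auto
  \<comment> \<open>Only the summand 0 is contracted, and its correction terms cancel all the other
    summands.\<close>
  finally show ?thesis
    by (simp add: act_contract[OF r ne h(3)])
qed

text \<open>What remains beyond the unobstructed case is the overlap: when \<open>w\<close> and the
  first letter of one summand form a forbidden word, the first letter of every summand is contracted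
  into \<open>w\<close>.\<close>

lemma relation_act:
  assumes w: "rooted H w" and h: "h \<in> hedges H" "i < width b h" "j < width b h"
  shows "(\<Sum>k<width (\<not> b) h. letter_act H (bi (\<not> b) h k j)
      (letter_act H (bi b h i k) (mon w :: ('v, 'e, 'k::field) free)))
    = (if i = j then letter_act H (Vert (ends H b h ! i)) (mon w) else 0)"
proof -
  let ?m = "mon :: _ \<Rightarrow> ('v, 'e, 'k) free"
  show ?thesis
  proof (cases "erange H (last w) = ends H b h ! i")
    case False
    then show ?thesis
      by (auto simp: act_mismatch act_Vert)
  next
    case match: True
    show ?thesis
    proof (cases "[last w, bi b h i 0] \<in> forbidden H")
      case False
      then show ?thesis
        using relation_act_not_forbidden[where 'k = 'k, OF w h match False] match
        by (cases "i = j") (simp_all add: act_Vert)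
    next
      case True
      then obtain l where i: "i = 0" and l: "l < width (\<not> b) h" and "last w = bi (\<not> b) h l 0"
        by (auto simp: forbidden_bi_iff)
      then obtain u where wu: "w = u @ [bi (\<not> b) h l 0]"
        using w that[of "butlast w"] append_butlast_last_id[of w] by simp
      have une: "u \<noteq> []"
        using w by (auto simp: rooted_def wu)
      note r = w[unfolded wu]
      have c: "letter_act H (bi b h 0 k) (?m w) =
          (if l = k then ?m u else 0) - (\<Sum>m = 1..<width b h. letter_act H (bi b h m k) (?m (u @ [bi (\<not> b) h l m])))"
        if k: "k < width (\<not> b) h" for k
      proof -
        have "letter_act H (bi b h m k) (?m (u @ [bi (\<not> b) h l m])) = ?m (u @ [bi (\<not> b) h l m, bi b h m k])"
          if "m \<in> {1..<width b h}" for m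
          using rooted_sibling2[OF r une k, of m] that act_append[of "u @ [bi (\<not> b) h l m]"] by simp
        then show ?thesis
          by (simp add: wu act_contract[OF r une k, unfolded not_not])
      qed
      \<comment> \<open>Correction terms have \<open>m\<close> at least 1, so they do not obstruct
        \<open>bi b h m k\<close>, and the previous lemma applies with \<open>m\<close> in the role
        of \<open>i\<close>.\<close>
      have A: "(\<Sum>k<width (\<not> b) h. letter_act H (bi (\<not> b) h k j)
            (letter_act H (bi b h m k) (?m (u @ [bi (\<not> b) h l m])))) =
          (if m = j then ?m (u @ [bi (\<not> b) h l m]) else 0)"
        if m: "m \<in> {1..<width b h}" for m
        using m h l rooted_sibling[OF r une, of m]
        by (intro relation_act_not_forbidden) (auto simp: forbidden_bi_iff)
      \<comment> \<open>The diagonal part of the first contraction survives only for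
        \<open>k = l\<close>.\<close>
      have B: "(\<Sum>k<width (\<not> b) h. letter_act H (bi (\<not> b) h k j) (if l = k then ?m u else 0)) =
          ?m (u @ [bi (\<not> b) h l j])"
        (is "?L = _")
      proof -
        have "?L = (\<Sum>k<width (\<not> b) h. if l = k then letter_act H (bi (\<not> b) h l j) (?m u) else 0)"
          by (intro sum.cong) auto
        also have "\<dots> = letter_act H (bi (\<not> b) h l j) (?m u)"
          using l by simp
        also have "\<dots> = ?m (u @ [bi (\<not> b) h l j])"
          using rooted_sibling[OF r une, of j] une h by (simp add: act_append)
        finally show ?thesis .
      qed
      have "(\<Sum>k<width (\<not> b) h. letter_act H (bi (\<not> b) h k j) (letter_act H (bi b h i k) (?m w))) =
          (\<Sum>k<width (\<not> b) h. letter_act H (bi (\<not> b) h k j) (if l = k then ?m u else 0)) -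
          (\<Sum>k<width (\<not> b) h. \<Sum>m = 1..<width b h. letter_act H (bi (\<not> b) h k j)
             (letter_act H (bi b h m k) (?m (u @ [bi (\<not> b) h l m]))))"
        unfolding i sum_subtractf[symmetric]
        by (intro sum.cong refl) (simp only: c lessThan_iff letter_act.diff letter_act.sum)
      also have "\<dots> = ?m (u @ [bi (\<not> b) h l j]) -
          (\<Sum>m = 1..<width b h. if m = j then ?m (u @ [bi (\<not> b) h l m]) else 0)"
        by (subst sum.swap) (simp only: A B cong: sum.cong)
      \<comment> \<open>For \<open>j = 0\<close> the sum vanishes and the first word is
        \<open>w\<close>; for positive \<open>j\<close> the term \<open>m = j\<close> cancels the
        first word.\<close>
      also have "\<dots> = (if i = j then ?m w else 0)"
        using h(3) by (simp add: i wu)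
      finally show ?thesis
        using match by (simp add: act_Vert)
    qed
  qed
qed

text \<open>Recording the range lets \<open>Vert (erange H x)\<close> act as the identity on the
  result, as the relations with a vertex on the right require. A contraction respects it: correction
  terms end in a letter with the range of \<open>x\<close>, and the diagonal term occurs only for
  \<open>i = j\<close>, when \<open>u\<close> ends at that same vertex.\<close>

lemma act_in_span:
  assumes w: "rooted H w" and x: "x \<in> letters H"
  shows "act H w x \<in> fs.span {mon u | u. rooted H u \<and> erange H (last u) = erange H x}"
    (is "_ \<in> fs.span ?S")
proof (cases "erange H (last w) = esource H x")
  case False
  then show ?thesis
    by (simp add: act_mismatch fs.span_zero)
next
  case match: True
  show ?thesis
  proof (cases "x \<in> edge_letters H \<and> [last w, x] \<in> forbidden H")
    case False
    show ?thesis
    proof (cases "x \<in> edge_letters H")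
      case True
      then have "rooted H (w @ [x])"
        using w match False by (simp add: rooted_snoc)
      then show ?thesis
        using w by (subst act_append) (auto intro!: fs.span_base)
    next
      case False
      then obtain v where "x = Vert v"
        using x by (auto simp: letters_def)
      then show ?thesis
        using w match by (auto simp: act_Vert intro: fs.span_base)
    qed
  next
    case True
    then obtain b h i j where h: "h \<in> hedges H" "i < width b h" "j < width b h"
      and lx: "last w = bi b h i 0" "x = bi (\<not> b) h 0 j"
      by (auto simp: forbidden_iff)
    then obtain u where wu: "w = u @ [bi b h i 0]"
      using w that[of "butlast w"] append_butlast_last_id[of w] by simp
    have une: "u \<noteq> []"
      using w by (auto simp: rooted_def wu)
    note r = w[unfolded wu]
    have "rooted H u" "erange H (last u) = ends H b h ! i"
      using r une by (simp_all add: rooted_snoc)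
    then show ?thesis
      unfolding wu lx act_contract[OF r une h(3)]
      using rooted_sibling2[OF r une h(3)]
      by (intro fs.span_diff fs.span_sum) (auto intro!: fs.span_base simp: fs.span_zero)
  qed
qed

lemma letter_act_rooted_space:
  fixes q :: "('v, 'e, 'k::field) free"
  assumes "q \<in> rooted_space H" "x \<in> letters H"
  shows "letter_act H x q \<in> rooted_space H"
  using assms(1) unfolding rooted_space_def
proof (induction q rule: fs.span_induct_alt)
  case (step c q p)
  then obtain w where w: "rooted H w" "q = mon w"
    by auto
  have "(act H w x :: ('v, 'e, 'k) free) \<in> fs.span {mon w | w. rooted H w}"
    using act_in_span[OF w(1) assms(2)] fs.span_mono[of _ "{mon w | w. rooted H w}"]
    by (smt (verit) Collect_mono subsetD)
  then show ?case
    using step w by (simp add: letter_act.add letter_act.scale fs.span_add fs.span_scale)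
qed (simp add: fs.span_zero)

lemma ract_rooted_space:
  assumes "q \<in> rooted_space H" "p \<in> free_alg H"
  shows "ract (letter_act H) q p \<in> rooted_space H"
proof -
  have "foldl (\<lambda>q x. letter_act H x q) q u \<in> rooted_space H" if "set u \<subseteq> letters H" for u
    using assms(1) that by (induction u arbitrary: q) (simp_all add: letter_act_rooted_space)
  then show ?thesis
    using assms(2) unfolding ract_def lext_def rooted_space_def free_alg_def
    by (intro fs.span_sum fs.span_scale) auto
qed

lemma act_range:
  assumes "rooted H w" "x \<in> letters H"
  shows "letter_act H (Vert (erange H x)) (act H w x) = (act H w x :: ('v, 'e, 'k::field) free)"
  using act_in_span[OF assms]
  by (induction rule: fs.span_induct_alt) (auto simp: letter_act.add letter_act.scale act_Vert)

lemma act_source: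
  "letter_act H x (letter_act H (Vert (esource H x)) (mon w)) = (act H w x :: ('v, 'e, 'k::field) free)"
  by (simp add: act_Vert act_mismatch)

section \<open>Vanishing of the action of the ideal\<close>

lemma rels_act:
  fixes p :: "('v, 'e, 'k::field) free"
  assumes "p \<in> lpa_rels H" "rooted H w"
  shows "ract (letter_act H) (mon w) p = 0"
  using assms(1)
proof cases
  case (vert_vert u v)
  then show ?thesis
    by (auto simp: ract_right.diff ract_mon act_Vert)
next
  case (src_edge h i j)
  then show ?thesis
    using act_source[where 'k = 'k, of "bi True h i j" w] by (simp add: ract_right.diff ract_mon bi_def ends_def)
next
  case (edge_rng h i j)
  then show ?thesis
    using act_range[where 'k = 'k, OF assms(2), of "bi True h i j"]
    by (simp add: ract_right.diff ract_mon bi_def ends_def letters_def edge_letters_def)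
next
  case (rng_ghost h i j)
  then show ?thesis
    using act_source[where 'k = 'k, of "bi False h j i" w] by (simp add: ract_right.diff ract_mon bi_def ends_def)
next
  case (ghost_src h i j)
  then show ?thesis
    using act_range[where 'k = 'k, OF assms(2), of "bi False h j i"]
    by (simp add: ract_right.diff ract_mon bi_def ends_def letters_def edge_letters_def)
next
  case (edge_ghost h i j)
  then show ?thesis
    using relation_act[where 'k = 'k, OF assms(2), of h i True j]
    by (cases "i = j")
       (simp_all add: ract_right.diff ract_right.sum ract_mon size_src size_rng bi_def ends_def)
next
  case (ghost_edge h i j)
  then show ?thesis
    using relation_act[where 'k = 'k, OF assms(2), of h i False j]
    by (cases "i = j")
       (simp_all add: ract_right.diff ract_right.sum ract_mon size_src size_rng bi_def ends_def)
qed

lemma ideal_act: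
  fixes p q :: "('v, 'e, 'k::field) free"
  assumes "p \<in> lpa_ideal H" "q \<in> rooted_space H"
  shows "ract (letter_act H) q p = 0"
proof -
  \<comment> \<open>The annihilator of a module is a two-sided ideal. Stability under left
    multiplication uses that the rooted space is invariant: \<open>a\<close> first sends
    \<open>q\<close> to another rooted element, which \<open>x\<close> then kills.\<close>
  let ?J = "{p :: ('v, 'e, 'k) free. p \<in> free_alg H \<and> (\<forall>q\<in>rooted_space H. ract (letter_act H) q p = 0)}"
  have "fs.subspace ?J"
    by (intro fs.subspaceI)
       (auto simp: ract_right.add ract_right.scale fs.subspace_add[OF subspace_free_alg]
          fs.subspace_scale[OF subspace_free_alg] fs.subspace_0[OF subspace_free_alg])
  moreover have "a * x \<in> ?J \<and> x * a \<in> ?J" if "a \<in> free_alg H" "x \<in> ?J" for a x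
    using that
    by (simp add: free_alg_mult ract_mult[OF letter_act.module_hom_axioms] ract_rooted_space)
  ultimately have "algebra_ideal H ?J"
    unfolding algebra_ideal_def by blast
  moreover have "lpa_rels H \<subseteq> ?J"
  proof
    fix r :: "('v, 'e, 'k) free" assume r: "r \<in> lpa_rels H"
    have "ract (letter_act H) q r = 0" if "q \<in> rooted_space H" for q
      using that unfolding rooted_space_def
      by (rule ract_left.eq_0_on_span[rotated]) (auto simp: rels_act r)
    then show "r \<in> ?J"
      using lpa_rels_free_alg[OF hypergraph listings] r by blast
  qed
  ultimately have "lpa_ideal H \<subseteq> ?J"
    unfolding lpa_ideal_def by blast
  then show ?thesis
    using assms by blast
qed


section \<open>Linear independence of nod-paths\<close>

definition root :: "('v, 'e) letter list \<Rightarrow> ('v, 'e) letter list" where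
  "root w = (if hd w \<in> range Vert then w else Vert (esource H (hd w)) # w)"

definition unroot :: "('v, 'e) letter list \<Rightarrow> ('v, 'e) letter list" where
  "unroot w = (if tl w = [] then w else tl w)"

lemma esource_in_verts: "x \<in> letters H \<Longrightarrow> esource H x \<in> verts H"
  and erange_in_verts: "x \<in> letters H \<Longrightarrow> erange H x \<in> verts H"
  by (auto elim!: letters_cases intro: ends_in_verts)

text \<open>Forbidden words have length exactly two, so avoiding them is a condition on adjacent
  letters.\<close>

lemma forbidden_sublist_iff:
  "(\<forall>u\<in>forbidden H. \<not> sublist u w) \<longleftrightarrow> successively (\<lambda>x y. [x, y] \<notin> forbidden H) w"
proof (induction w)
  case Nil
  show ?case
    by (auto simp: forbidden_iff)
next
  case (Cons x w)
  have "(\<forall>u\<in>forbidden H. \<not> prefix u (x # w)) \<longleftrightarrow> w = [] \<or> [x, hd w] \<notin> forbidden H"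
  proof (cases w)
    case Nil
    then show ?thesis
      by (auto simp: forbidden_iff)
  next
    case w: (Cons y v)
    have "prefix u (x # w) \<longleftrightarrow> u = [x, y]" if "u \<in> forbidden H" for u
      using that w by (auto simp: forbidden_iff)
    then show ?thesis
      using w by auto
  qed
  then show ?case
    using Cons.IH by (auto simp: successively_Cons sublist_Cons_right)
qed

lemma successively_conj:
  "successively (\<lambda>x y. P x y \<and> Q x y) w \<longleftrightarrow> successively P w \<and> successively Q w"
  by (induction w) (auto simp: successively_Cons)

lemma Vert_not_forbidden: "[Vert v, x] \<notin> forbidden H"
  by (auto simp: forbidden_iff)

lemma nod_path_cases [consumes 1, case_names Vert edges]:
  assumes "nod_path H w"
  obtains v where "v \<in> verts H" "w = [Vert v]"
  | x es where "w = x # es" "x \<in> edge_letters H" "rooted H (Vert (esource H x) # x # es)"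
  using assms unfolding nod_path_def d_path_def
proof (elim conjE disjE bexE)
  assume w: "w \<noteq> []" "set w \<subseteq> edge_letters H" "successively (\<lambda>x y. erange H x = esource H y) w"
    and f: "\<forall>u\<in>forbidden H. \<not> sublist u w"
  then obtain x es where x: "w = x # es"
    by (cases w) auto
  moreover have "x \<in> edge_letters H"
    using w x by simp
  moreover have "rooted H (Vert (esource H x) # w)"
    using w f x esource_in_verts[of x]
    by (simp add: rooted_def successively_Cons Vert_not_forbidden forbidden_sublist_iff successively_conj
        letters_def)
  ultimately show ?thesis
    using that(2) by blast
qed (use that in blast)

lemma nod_path_unroot: "rooted H w \<Longrightarrow> nod_path H (unroot w)"
proof -
  assume w: "rooted H w"
  then obtain v es where v: "w = Vert v # es" "v \<in> verts H"
    by (cases w) (auto simp: rooted_def)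
  show "nod_path H (unroot w)"
    using w v
    by (cases es)
       (auto simp: nod_path_def d_path_def unroot_def rooted_def forbidden_sublist_iff successively_conj)
qed

lemma rooted_prefix: "rooted H (u @ w) \<Longrightarrow> u \<noteq> [] \<Longrightarrow> rooted H u"
  by (auto simp: rooted_def successively_append_iff)

lemma foldl_letter_act_zero: "foldl (\<lambda>q x. letter_act H x q) 0 u = 0"
  by (induction u) simp_all

text \<open>Every nonempty prefix of a rooted word is rooted, so no contraction occurs on the way
  and the action is plain concatenation.\<close>

lemma foldl_letter_act_rooted:
  assumes "rooted H (w @ es)" "w \<noteq> []"
  shows "foldl (\<lambda>q x. letter_act H x q) (mon w) es = (mon (w @ es) :: ('v, 'e, 'k::field) free)"
  using assms
proof (induction es arbitrary: w)
  case (Cons x es)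
  have "rooted H (w @ [x])"
    using Cons.prems rooted_prefix[of "w @ [x]" es] by simp
  then show ?case
    using Cons by (simp add: act_append)
qed simp

lemma ract_Vert_nod_path:
  assumes "nod_path H u"
  shows "ract (letter_act H) (mon [Vert v]) (mon u) =
    (if esource H (hd u) = v then mon (root u) else (0 :: ('v, 'e, 'k::field) free))"
  using assms
proof (cases rule: nod_path_cases)
  case (Vert u)
  then show ?thesis
    by (simp add: ract_mon act_Vert root_def)
next
  case (edges x es)
  have "x \<notin> range Vert"
    using edges(2) by auto
  moreover have "ract (letter_act H) (mon [Vert v]) (mon u) = (0 :: ('v, 'e, 'k) free)"
    if "esource H x \<noteq> v"
    using that edges(1) by (simp add: ract_mon act_mismatch foldl_letter_act_zero)
  moreover have "ract (letter_act H) (mon [Vert (esource H x)]) (mon u) =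
      (mon (Vert (esource H x) # u) :: ('v, 'e, 'k) free)"
    using foldl_letter_act_rooted[where 'k = 'k, of "[Vert (esource H x)]" "x # es"] edges
    by (simp add: ract_mon)
  ultimately show ?thesis
    using edges(1) by (auto simp: root_def)
qed

lemma unroot_root: "nod_path H u \<Longrightarrow> unroot (root u) = u"
  by (cases u rule: nod_path_cases) (auto simp: unroot_def root_def)

text \<open>Distinct nod-paths thus yield distinct basis words, so their coefficients cannot
  mix.\<close>

lemma root_inject: "nod_path H u \<Longrightarrow> nod_path H w \<Longrightarrow> root u = root w \<longleftrightarrow> u = w"
  by (metis unroot_root)

section \<open>The span of the nod-paths and its intersection with the ideal\<close>

lemma nod_path_letters:
  assumes "nod_path H w"
  shows "w \<noteq> []" "set w \<subseteq> letters H"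
  using assms by (auto simp: nod_path_def d_path_def letters_def)

definition nods :: "('v, 'e, 'k::field) free set" where
  "nods = fs.span {mon w | w. nod_path H w}"

lemma keys_nods:
  assumes "p \<in> nods" "w \<in> Poly_Mapping.keys p"
  shows "nod_path H w"
  using assms unfolding nods_def
proof (induction p arbitrary: w rule: fs.span_induct_alt)
  case (step c x y)
  then obtain u where u: "x = mon u" "nod_path H u"
    by blast
  have "Poly_Mapping.keys (fscale c x) \<subseteq> {u}"
    by (auto simp: u in_keys_iff lookup_fscale mon_def lookup_single when_def split: if_splits)
  then show ?case
    using step.prems step.IH u(2) Poly_Mapping.keys_add[of "fscale c x" y] by blast
qed simp

lemma nods_free_alg: "(nods :: ('v, 'e, 'k::field) free set) \<subseteq> free_alg H"
  using keys_nods nod_path_letters by (fastforce simp: free_alg_def)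

lemma nods_ideal:
  fixes p :: "('v, 'e, 'k::field) free"
  assumes "p \<in> nods" "p \<in> lpa_ideal H"
  shows "p = 0"
proof (rule ccontr)
  assume "p \<noteq> 0"
  then obtain w where w: "w \<in> Poly_Mapping.keys p"
    by (metis all_not_in_conv keys_eq_empty)
  \<comment> \<open>Acting on the source of \<open>w\<close> guarantees that the term of
    \<open>w\<close> is among the survivors.\<close>
  let ?v = "esource H (hd w)"
  have nod: "nod_path H u" if "u \<in> Poly_Mapping.keys p" for u
    using keys_nods[OF assms(1) that] .
  have "?v \<in> verts H"
    using nod_path_letters[OF nod[OF w]] hd_in_set by (intro esource_in_verts) blast
  then have "0 = ract (letter_act H) (mon [Vert ?v]) p"
    using assms(2) by (intro ideal_act[symmetric] mon_rooted_space rooted_Vert)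
  also have "\<dots> = (\<Sum>u\<in>Poly_Mapping.keys p.
      fscale (Poly_Mapping.lookup p u) (if esource H (hd u) = ?v then mon (root u) else 0))"
    unfolding ract_def lext_def
    by (intro sum.cong refl) (simp only: ract_Vert_nod_path[OF nod, unfolded ract_mon])
  finally have "Poly_Mapping.lookup 0 (root w) = Poly_Mapping.lookup (\<Sum>u\<in>Poly_Mapping.keys p.
      fscale (Poly_Mapping.lookup p u) (if esource H (hd u) = ?v then mon (root u) else 0)) (root w)"
    by (rule arg_cong)
  then have "0 = (\<Sum>u\<in>Poly_Mapping.keys p. Poly_Mapping.lookup p u *
      Poly_Mapping.lookup (if esource H (hd u) = ?v then mon (root u) else (0 :: ('v, 'e, 'k) free)) (root w))"
    by (simp only: lookup_sum lookup_fscale lookup_zero)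
  \<comment> \<open>Of the nod-paths sharing the source of \<open>w\<close>, only \<open>w\<close>
    itself contributes to the coefficient at \<open>root w\<close>.\<close>
  also have "\<dots> = (\<Sum>u\<in>Poly_Mapping.keys p. if u = w then Poly_Mapping.lookup p w else 0)"
    using nod w by (intro sum.cong refl) (auto simp: mon_def lookup_single when_def root_inject)
  also have "\<dots> = Poly_Mapping.lookup p w"
    using w by simp
  finally show False
    using w by (simp add: in_keys_iff)
qed

section \<open>Reduction to nod-paths\<close>

definition lcong :: "('v, 'e, 'k::field) free \<Rightarrow> ('v, 'e, 'k) free \<Rightarrow> bool" (infix \<open>\<approx>\<close> 50) where
  "p \<approx> q \<longleftrightarrow> p - q \<in> lpa_ideal H"

lemma
  fixes p q :: "('v, 'e, 'k::field) free"
  shows subspace_ideal: "fs.subspace (lpa_ideal H :: ('v, 'e, 'k) free set)"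
    and mult_ideal: "p \<in> free_alg H \<Longrightarrow> q \<in> lpa_ideal H \<Longrightarrow> p * q \<in> lpa_ideal H"
    "p \<in> free_alg H \<Longrightarrow> q \<in> lpa_ideal H \<Longrightarrow> q * p \<in> lpa_ideal H"
  using algebra_ideal_lpa_ideal[where 'k = 'k, OF hypergraph listings]
  by (simp_all add: algebra_ideal_def)

lemma rels_ideal: "p \<in> lpa_rels H \<Longrightarrow> (p :: ('v, 'e, 'k::field) free) \<in> lpa_ideal H"
  by (auto simp: lpa_ideal_def)

lemma lcong_refl [simp]: "p \<approx> p"
  by (simp add: lcong_def fs.subspace_0[OF subspace_ideal])

lemma lcong_sym: "p \<approx> q \<Longrightarrow> q \<approx> p"
  using fs.subspace_neg[OF subspace_ideal, of "p - q"] by (simp add: lcong_def)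

lemma lcong_trans [trans]: "p \<approx> q \<Longrightarrow> q \<approx> r \<Longrightarrow> p \<approx> r"
  using fs.subspace_add[OF subspace_ideal, of "p - q" "q - r"] by (simp add: lcong_def)

lemma lcong_add: "p \<approx> q \<Longrightarrow> p' \<approx> q' \<Longrightarrow> p + p' \<approx> q + q'"
  using fs.subspace_add[OF subspace_ideal, of "p - q" "p' - q'"]
  by (simp add: lcong_def algebra_simps)

lemma lcong_scale: "p \<approx> q \<Longrightarrow> fscale c p \<approx> fscale c q"
  using fs.subspace_scale[OF subspace_ideal, of "p - q" c]
  by (simp add: lcong_def fs.scale_right_diff_distrib)

lemma mon_Nil: "mon [] = 1"
  by (simp add: mon_def zero_list_def flip: single_one)

lemma lcong_mult_mon:
  fixes p q :: "('v, 'e, 'k::field) free"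
  assumes "p \<approx> q" "set u \<subseteq> letters H"
  shows "mon u * p \<approx> mon u * q" "p * mon u \<approx> q * mon u"
proof -
  have "mon u * (p - q) \<in> lpa_ideal H \<and> (p - q) * mon u \<in> lpa_ideal H"
  \<comment> \<open>The empty word lies outside the nonunital \<open>free_alg H\<close>, so the
    ideal property does not cover it; it multiplies as 1.\<close>
  proof (cases "u = []")
    case False
    with assms(2) have "(mon u :: ('v, 'e, 'k) free) \<in> free_alg H"
      by (simp add: free_alg_def mon_def)
    then show ?thesis
      using assms(1) mult_ideal[of "mon u" "p - q"] by (simp add: lcong_def)
  qed (use assms(1) in \<open>simp add: mon_Nil lcong_def\<close>)
  then show "mon u * p \<approx> mon u * q" "p * mon u \<approx> q * mon u"
    by (simp_all add: lcong_def algebra_simps)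
qed

lemma lcong_source:
  assumes "x \<in> letters H"
  shows "mon [Vert (esource H x), x] \<approx> (mon [x] :: ('v, 'e, 'k::field) free)"
  using assms
proof (cases rule: letters_cases)
  case (Vert v)
  have "mon [Vert v, Vert v] - (if v = v then mon [Vert v] else 0) \<in> (lpa_ideal H :: ('v, 'e, 'k) free set)"
    using Vert by (intro rels_ideal lpa_rels.vert_vert)
  then show ?thesis
    by (simp add: lcong_def Vert)
next
  case (bi b h i j)
  then show ?thesis
    by (cases b) (auto simp: lcong_def bi_def ends_def size_src size_rng
      intro!: rels_ideal lpa_rels.src_edge lpa_rels.rng_ghost)
qed

lemma lcong_range:
  assumes "x \<in> letters H"
  shows "mon [x, Vert (erange H x)] \<approx> (mon [x] :: ('v, 'e, 'k::field) free)"
  using assms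
proof (cases rule: letters_cases)
  case (Vert v)
  have "mon [Vert v, Vert v] - (if v = v then mon [Vert v] else 0) \<in> (lpa_ideal H :: ('v, 'e, 'k) free set)"
    using Vert by (intro rels_ideal lpa_rels.vert_vert)
  then show ?thesis
    by (simp add: lcong_def Vert)
next
  case (bi b h i j)
  then show ?thesis
    by (cases b) (auto simp: lcong_def bi_def ends_def size_src size_rng
      intro!: rels_ideal lpa_rels.edge_rng lpa_rels.ghost_src)
qed

text \<open>Inserting the range of \<open>x\<close> and the source of \<open>y\<close> between the
  two letters produces a product of distinct, hence orthogonal, vertices.\<close>

lemma lcong_mismatch:
  assumes x: "x \<in> letters H" and y: "y \<in> letters H" and "erange H x \<noteq> esource H y"
  shows "mon [x, y] \<approx> (0 :: ('v, 'e, 'k::field) free)"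
proof -
  have "mon [Vert (erange H x), Vert (esource H y)] \<approx> (0 :: ('v, 'e, 'k) free)"
    using rels_ideal[where 'k = 'k, OF lpa_rels.vert_vert[OF erange_in_verts[OF x] esource_in_verts[OF y]]]
      assms(3)
    by (simp add: lcong_def)
  note 0 = lcong_mult_mon(1)[OF lcong_mult_mon(2)[OF this, of "[y]"], of "[x]"]
  have "mon [x] * mon [y] \<approx> (mon [x, Vert (erange H x)] * mon [y] :: ('v, 'e, 'k) free)"
    using y by (intro lcong_mult_mon lcong_sym[OF lcong_range[OF x]]) simp
  also have "\<dots> \<approx> mon [x, Vert (erange H x)] * mon [Vert (esource H y), y]"
    using x erange_in_verts[OF x]
    by (intro lcong_mult_mon lcong_sym[OF lcong_source[OF y]]) (simp add: letters_def)
  also have "\<dots> \<approx> 0"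
    using 0 x y by (simp add: mon_mult)
  finally show ?thesis
    by (simp add: mon_mult)
qed

text \<open>This is the defining relation solved for its summand 0. The vertex is still visible
  here, as no preceding path absorbs it.\<close>

lemma lcong_contract:
  assumes h: "h \<in> hedges H" "i < width b h" "j < width b h"
  shows "mon [bi b h i 0, bi (\<not> b) h 0 j] \<approx>
    (if i = j then mon [Vert (ends H b h ! i)] else 0)
     - (\<Sum>k = 1..<width (\<not> b) h. (mon [bi b h i k, bi (\<not> b) h k j] :: ('v, 'e, 'k::field) free))"
proof -
  let ?m = "\<lambda>k. mon [bi b h i k, bi (\<not> b) h k j] :: ('v, 'e, 'k) free"
  have "(\<Sum>k<width (\<not> b) h. ?m k) - (if i = j then mon [Vert (ends H b h ! i)] else 0) \<in> lpa_ideal H"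
    using rels_ideal[where 'k = 'k, OF lpa_rels.edge_ghost[of h H i j]]
      rels_ideal[where 'k = 'k, OF lpa_rels.ghost_edge[of h H i j]] h
    by (cases b; cases "i = j") (simp_all add: bi_def ends_def size_src size_rng)
  moreover have "{..<width (\<not> b) h} = insert 0 {1..<width (\<not> b) h}"
    using width_pos[OF h(1), of "\<not> b"] by auto
  then have "(\<Sum>k<width (\<not> b) h. ?m k) = ?m 0 + (\<Sum>k = 1..<width (\<not> b) h. ?m k)"
    by simp
  ultimately show ?thesis
    unfolding lcong_def by (simp only: algebra_simps)
qed

lemma rooted_letters:
  assumes "rooted H w"
  shows "set w \<subseteq> letters H"
  using assms by (cases w) (auto simp: rooted_def letters_def)

lemma lcong_act:
  assumes w: "rooted H w" and x: "x \<in> letters H"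
  shows "mon (w @ [x]) \<approx> (act H w x :: ('v, 'e, 'k::field) free)"
proof -
  let ?m = "mon :: _ \<Rightarrow> ('v, 'e, 'k) free"
  obtain u y where u: "w = u @ [y]"
    using rooted_nonempty[OF w] by (cases w rule: rev_cases) auto
  have ul: "set u \<subseteq> letters H" and y: "y \<in> letters H"
    using rooted_letters[OF w] by (auto simp: u)
  show ?thesis
  proof (cases "erange H y = esource H x")
    case False
    then show ?thesis
      using lcong_mult_mon(1)[OF lcong_mismatch[where 'k = 'k, OF y x False] ul]
      by (simp add: u act_mismatch mon_mult)
  next
    case match: True
    show ?thesis
    proof (cases "x \<in> edge_letters H")
      case False
      then obtain v where v: "x = Vert v"
        using x by (auto simp: letters_def)
      then show ?thesis
        using lcong_mult_mon(1)[OF lcong_range[where 'k = 'k, OF y] ul] match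
        by (simp add: u act_Vert mon_mult)
    next
      case edge: True
      show ?thesis
      proof (cases "[y, x] \<in> forbidden H")
        case False
        then have "rooted H (w @ [x])"
          using w edge match by (subst rooted_snoc) (simp_all add: u)
        then show ?thesis
          using w by (simp add: act_append)
      next
        case True
        then obtain b h i j where h: "h \<in> hedges H" "i < width b h" "j < width b h"
          and yx: "y = bi b h i 0" "x = bi (\<not> b) h 0 j"
          by (auto simp: forbidden_iff)
        have une: "u \<noteq> []"
          using w by (auto simp: rooted_def u yx)
        note r = w[unfolded u yx]
        obtain u' z where u': "u = u' @ [z]"
          using une by (cases u rule: rev_cases) auto
        have z: "z \<in> letters H" and ul': "set u' \<subseteq> letters H"
          using ul by (simp_all add: u')
        \<comment> \<open>The nonempty path \<open>u\<close> ends at the vertex of the diagonal term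
          and absorbs it, which reconciles the relation with \<open>contract\<close>.\<close>
        have "erange H z = ends H b h ! i"
          using r unfolding rooted_snoc[OF une] by (simp add: u')
        then have V: "?m (u @ [Vert (ends H b h ! i)]) \<approx> ?m u"
          using lcong_mult_mon(1)[OF lcong_range[where 'k = 'k, OF z] ul'] by (simp add: mon_mult u')
        have "?m (w @ [x]) = ?m u * ?m [bi b h i 0, bi (\<not> b) h 0 j]"
          by (simp add: mon_mult u yx)
        also have "\<dots> \<approx> ?m u * ((if i = j then ?m [Vert (ends H b h ! i)] else 0)
            - (\<Sum>k = 1..<width (\<not> b) h. ?m [bi b h i k, bi (\<not> b) h k j]))"
          by (intro lcong_mult_mon ul lcong_contract h)
        \<comment> \<open>The difference is written as a sum with a negated term so that additivity
          of the congruence applies.\<close>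
        also have "\<dots> = (if i = j then ?m (u @ [Vert (ends H b h ! i)]) else 0)
            + - (\<Sum>k = 1..<width (\<not> b) h. ?m (u @ [bi b h i k, bi (\<not> b) h k j]))"
          by (simp add: algebra_simps sum_distrib_left mon_mult)
        also have "\<dots> \<approx> (if i = j then ?m u else 0)
            + - (\<Sum>k = 1..<width (\<not> b) h. ?m (u @ [bi b h i k, bi (\<not> b) h k j]))"
          using V by (intro lcong_add) (cases "i = j"; simp)+
        also have "\<dots> = act H w x"
          by (simp add: u yx act_contract[OF r une h(3)])
        finally show ?thesis .
      qed
    qed
  qed
qed

lemma lcong_letter_act:
  assumes "q \<in> rooted_space H" "x \<in> letters H"
  shows "q * mon [x] \<approx> letter_act H x q"
  using assms(1) unfolding rooted_space_def
proof (induction q rule: fs.span_induct_alt)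
  case (step c q p)
  then show ?case
    using assms(2)
    by (auto simp: distrib_right letter_act.add letter_act.scale fscale_mult_left mon_mult
        intro!: lcong_add lcong_scale lcong_act)
qed simp

lemma word_lcong_rooted:
  assumes "u \<noteq> []" "set u \<subseteq> letters H"
  shows "\<exists>q\<in>rooted_space H. mon u \<approx> (q :: ('v, 'e, 'k::field) free)"
  using assms
proof (induction u rule: rev_nonempty_induct)
  case (single x)
  \<comment> \<open>A single letter has no path to act on until its source is inserted in front of
    it.\<close>
  have v: "rooted H [Vert (esource H x)]"
    using single by (intro rooted_Vert esource_in_verts) simp
  have "mon [x] \<approx> (mon ([Vert (esource H x)] @ [x]) :: ('v, 'e, 'k) free)"
    using single lcong_sym[OF lcong_source[of x]] by simp
  also have "\<dots> \<approx> letter_act H x (mon [Vert (esource H x)])"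
    using single v lcong_act[where 'k = 'k, of "[Vert (esource H x)]" x] by simp
  finally show ?case
    using letter_act_rooted_space[OF mon_rooted_space[OF v], of x] single by force
next
  case (snoc x u)
  then obtain q :: "('v, 'e, 'k) free" where q: "q \<in> rooted_space H" "mon u \<approx> q"
    by auto
  have "mon (u @ [x]) = (mon u * mon [x] :: ('v, 'e, 'k) free)"
    by (simp add: mon_mult)
  also have "\<dots> \<approx> q * mon [x]"
    using snoc by (intro lcong_mult_mon q) simp
  also have "\<dots> \<approx> letter_act H x q"
    using q snoc by (intro lcong_letter_act) simp_all
  finally show ?case
    using letter_act_rooted_space[OF q(1), of x] snoc by auto
qed

lemma lcong_unroot:
  assumes "rooted H w"
  shows "mon w \<approx> (mon (unroot w) :: ('v, 'e, 'k::field) free)"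
proof -
  obtain v es where v: "w = Vert v # es"
    using assms by (cases w) (auto simp: rooted_def)
  show ?thesis
  proof (cases es)
    case (Cons e es')
    have "v = esource H e" "e \<in> letters H" "set es' \<subseteq> letters H"
      using assms rooted_letters[OF assms] by (auto simp: rooted_def v Cons)
    then show ?thesis
      using lcong_mult_mon(2)[OF lcong_source[where 'k = 'k, of e], of es'] by (simp add: v Cons unroot_def mon_mult)
  qed (simp add: v unroot_def)
qed

text \<open>The combination has the shape of the induction step over a span, and also yields sums
  and multiples for the subspace property.\<close>

lemma lcong_nods_closed:
  fixes p p' q q' :: "('v, 'e, 'k::field) free"
  assumes "q \<approx> p" "p \<in> nods" "q' \<approx> p'" "p' \<in> nods"
  shows "\<exists>r\<in>nods. fscale c q + q' \<approx> r"
  using assms unfolding nods_def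
  by (intro bexI[of _ "fscale c p + p'"] lcong_add lcong_scale) (auto intro: fs.span_add fs.span_scale)

lemma rooted_lcong_nods:
  fixes q :: "('v, 'e, 'k::field) free"
  assumes "q \<in> rooted_space H"
  shows "\<exists>p\<in>nods. q \<approx> p"
  using assms unfolding rooted_space_def
proof (induction q rule: fs.span_induct_alt)
  case base
  show ?case
    unfolding nods_def by (intro bexI[of _ 0] fs.span_zero) simp
next
  case (step c x y)
  then obtain w where w: "rooted H w" "x = mon w"
    by auto
  have n: "(mon (unroot w) :: ('v, 'e, 'k) free) \<in> nods"
    unfolding nods_def using nod_path_unroot[OF w(1)] by (auto intro: fs.span_base)
  obtain p where "p \<in> nods" "y \<approx> p"
    using step by blast
  with n show ?case
    unfolding w by (intro lcong_nods_closed[OF lcong_unroot[OF w(1)]])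
qed

lemma free_alg_lcong_nods:
  fixes p :: "('v, 'e, 'k::field) free"
  assumes "p \<in> free_alg H"
  shows "\<exists>q\<in>nods. p \<approx> q"
proof -
  let ?N = "{p :: ('v, 'e, 'k) free. \<exists>q\<in>nods. p \<approx> q}"
  have zero: "0 \<in> ?N"
    unfolding nods_def by (auto intro!: bexI[of _ 0] fs.span_zero)
  have closed: "fscale c q + q' \<in> ?N" if "q \<in> ?N" "q' \<in> ?N" for c q q'
    using that lcong_nods_closed by blast
  have "fs.subspace ?N"
  proof (rule fs.subspaceI[OF zero])
    show "q + q' \<in> ?N" if "q \<in> ?N" "q' \<in> ?N" for q q'
      using closed[OF that, of 1] by simp
    show "fscale c q \<in> ?N" if "q \<in> ?N" for c q
      using closed[OF that zero, of c] by simp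
  qed
  moreover have "mon w \<in> ?N" if "w \<in> Poly_Mapping.keys p" for w
    using that assms word_lcong_rooted[where 'k = 'k, of w] rooted_lcong_nods[where 'k = 'k] lcong_trans
    by (fastforce simp: free_alg_def)
  \<comment> \<open>Writing \<open>p\<close> as the combination of its own words reduces the claim
    to words over \<open>letters H\<close>.\<close>
  ultimately have "lext mon p \<in> ?N"
    unfolding lext_def by (intro fs.subspace_sum fs.subspace_scale)
  then show ?thesis
    by (simp add: lext_mon_id)
qed

section \<open>Normal forms\<close>

lemma lpa_class_eq_iff:
  fixes p q :: "('v, 'e, 'k::field) free"
  shows "lpa_class H p = lpa_class H q \<longleftrightarrow> p \<approx> q"
proof
  assume "lpa_class H p = lpa_class H q"
  moreover have "p \<in> lpa_class H p"
    using fs.subspace_0[OF subspace_ideal] by (force simp: lpa_class_def)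
  ultimately show "p \<approx> q"
    by (auto simp: lpa_class_def lcong_def)
next
  have *: "lpa_class H p \<subseteq> lpa_class H q" if "p \<approx> q" for p q :: "('v, 'e, 'k) free"
  proof
    fix y assume "y \<in> lpa_class H p"
    then obtain x where x: "y = q + ((p - q) + x)" "x \<in> lpa_ideal H"
      by (auto simp: lpa_class_def)
    have "(p - q) + x \<in> lpa_ideal H"
      using that x(2) unfolding lcong_def by (rule fs.subspace_add[OF subspace_ideal])
    with x(1) show "y \<in> lpa_class H q"
      unfolding lpa_class_def by blast
  qed
  assume "p \<approx> q"
  then show "lpa_class H p = lpa_class H q"
    using *[of p q] *[of q p] lcong_sym by blast
qed

lemma normal_rep_iff: "normal_rep H a p \<longleftrightarrow> lpa_class H p = a \<and> p \<in> nods"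
  using nods_free_alg by (auto simp: normal_rep_def nod_space_def nods_def)

lemma nods_lcong_unique:
  fixes p q :: "('v, 'e, 'k::field) free"
  assumes "p \<in> nods" "q \<in> nods" "p \<approx> q"
  shows "p = q"
proof -
  have "p - q \<in> nods"
    using assms(1,2) unfolding nods_def by (rule fs.span_diff)
  then show ?thesis
    using nods_ideal[of "p - q"] assms(3) by (simp add: lcong_def)
qed

lemma normal_rep_ex1:
  fixes p :: "('v, 'e, 'k::field) free"
  assumes "p \<in> free_alg H"
  shows "\<exists>!q. normal_rep H (lpa_class H p) q"
proof -
  obtain q where q: "q \<in> nods" "p \<approx> q"
    using free_alg_lcong_nods[OF assms] by blast
  show ?thesis
  proof
    show "normal_rep H (lpa_class H p) q"
      using q lcong_sym[OF q(2)] by (simp add: normal_rep_iff lpa_class_eq_iff)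
    show "r = q" if "normal_rep H (lpa_class H p) r" for r
      using that q nods_lcong_unique[of r q] lcong_trans[of r p q] by (simp add: normal_rep_iff lpa_class_eq_iff)
  qed
qed

lemma NF_lpa_class_eq:
  fixes p :: "('v, 'e, 'k::field) free"
  assumes "p \<in> nods"
  shows "NF H (lpa_class H p) = p"
  unfolding NF_def
  using assms nods_free_alg normal_rep_ex1[of p] by (intro the1_equality) (auto simp: normal_rep_iff)

text \<open>Indexing classes by combinations of nod-paths makes \<open>NF H\<close> computable on
  every class: it returns the index.\<close>

lemma LPA_carrier: "vcarrier (LPA H) = lpa_class H ` (nods :: ('v, 'e, 'k::field) free set)"
proof -
  have "lpa_class H p \<in> lpa_class H ` nods" if "p \<in> free_alg H" for p :: "('v, 'e, 'k) free"
    using free_alg_lcong_nods[OF that] by (auto simp: lpa_class_eq_iff)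
  then show ?thesis
    using nods_free_alg[where 'k = 'k] by (auto simp: LPA_def)
qed

lemma vspace_iso_NF:
  "vspace_iso (LPA H :: ('k::field, ('v, 'e, 'k) free set) algebra) (nod_space H) (NF H)"
proof -
  let ?V = "LPA H :: ('k, ('v, 'e, 'k) free set) algebra"
  let ?N = "nods :: ('v, 'e, 'k) free set"
  note simps = vzero_LPA[OF hypergraph listings] vadd_LPA[OF hypergraph listings]
    vscale_LPA[OF hypergraph listings]
  have sub: "fs.subspace ?N"
    unfolding nods_def by (rule fs.subspace_span)
  note closed = fs.subspace_0[OF sub] fs.subspace_add[OF sub] fs.subspace_scale[OF sub]
    fs.subspace_neg[OF sub]
  have N: "nod_space H = \<lparr>vcarrier = ?N, vzero = 0, vadd = (+), vscale = fscale\<rparr>"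
    by (simp add: nod_space_def nods_def)
  have V: "is_vspace ?V"
    \<comment> \<open>With the carrier an image, quantifiers over classes become quantifiers over
      representatives, and each law follows from the one in the free algebra.\<close>
    unfolding is_vspace_def LPA_carrier ball_simps simps
  proof (intro conjI ballI allI)
    fix p assume "p \<in> ?N"
    then show "\<exists>y\<in>lpa_class H ` ?N. vadd ?V y (lpa_class H p) = lpa_class H 0"
      by (intro bexI[of _ "lpa_class H (- p)"]) (auto simp: simps closed)
  qed (auto simp: simps closed fs.scale_right_distrib fs.scale_left_distrib add_ac)
  have W: "is_vspace (nod_space H :: ('k, ('v, 'e, 'k) free) vspace)"
    unfolding is_vspace_def N vspace.simps
  proof (intro conjI ballI allI)
    fix p assume "p \<in> ?N"
    then show "\<exists>q\<in>?N. q + p = 0"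
      by (intro bexI[of _ "- p"]) (simp_all add: closed)
  qed (simp_all add: closed fs.scale_right_distrib fs.scale_left_distrib add_ac)
  \<comment> \<open>The inverse is the quotient map restricted to the span of the nod-paths.\<close>
  have "bij_betw (NF H) (vcarrier ?V) ?N"
    by (rule bij_betw_byWitness[where f' = "lpa_class H"])
      (auto simp: LPA_carrier NF_lpa_class_eq)
  then show ?thesis
    unfolding vspace_iso_def using V W
    by (auto simp: N LPA_carrier simps NF_lpa_class_eq closed)
qed

end

theorem theorem17:
  fixes H :: "('v, 'e) listed_hypergraph"
  assumes "hypergraph H" and "listings H"
  shows "(\<forall>a \<in> vcarrier (LPA H :: ('k::field, ('v, 'e, 'k) free set) algebra).
            \<exists>!p. normal_rep H a p) \<and>
         vspace_iso (LPA H :: ('k, ('v, 'e, 'k) free set) algebra) (nod_space H) (NF H)"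
proof -
  interpret leavitt H
    using assms by (rule leavitt.intro)
  show ?thesis
  proof
    show "\<forall>a \<in> vcarrier (LPA H :: ('k, ('v, 'e, 'k) free set) algebra). \<exists>!p. normal_rep H a p"
      unfolding LPA_carrier using normal_rep_ex1 nods_free_alg by blast
  qed (rule vspace_iso_NF)
qed

end
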